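(* Let $\alpha>0$ and $\beta>1$, let $a=0\in\mathbb{R}^2$, let $r_A,c_M>0$, and let the constants $c_A$ and $c_B$ be sufficiently large (depending on $\alpha$ and $\beta$). Consider the random coefficient regression model $Y_j=A_{0,j}+A_{1,j}X_j$ and assume that the design density $f_X$ satisfies, for constants $C_X>c_X>0$, $$C_X(1+|x|)^{-\beta-2}\ \ge\ f_X(x)\ \ge\ c_X(1+|x|)^{-\beta-2}\qquad\forall x\in\mathbb{R}.$$ Let $(\hat f_n)_n$ be an arbitrary sequence of estimators of $f_A$, where for each $n$ the estimator $\hat f_n$ is based on the data $(X_j,Y_j)$, $j=1,\dots,n$. Then, with $\mathcal{F}=\mathcal{F}(0,\alpha,c_A,c_B,r_A,c_M)$, $$\liminf_{n\to\infty}\ n^{\frac{2\alpha}{(\alpha+2)(\beta+1)}}\ \sup_{f_A\in\mathcal{F}}\mathbb{E}_{f_A}\big[|\hat f_n(0)-f_A(0)|^2\big]>0 .$$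
   Context: Model: one observes i.i.d. data $(X_j,Y_j)$, $j=1,\dots,n$, with $Y_j=A_{0,j}+A_{1,j}X_j$, where $A_j=(A_{0,j},A_{1,j})$ are unobserved i.i.d. random vectors with bivariate Lebesgue density $f_A$, $A_j$ and $X_j$ are independent, and $X_j$ has Lebesgue density $f_X$ on $\mathbb{R}$. $\mathbb{E}_{f_A}$ is expectation when the coefficient density is $f_A$; $\psi_A(b)=\mathbb{E}\exp(i\,b^\top A_j)$ is the characteristic function of $A_j$. Notation: $|\cdot|$ is the Euclidean norm of a real or complex vector; $\lfloor\alpha\rfloor:=\max\{k\in\mathbb{N}_0: k<\alpha\}$ (largest integer strictly less than $\alpha$). Class $\mathcal{F}(a,\alpha,c_A,c_B,r_A,c_M)$ for $a=(a_0,a_1)\in\mathbb{R}^2$: all probability densities $f_A$ on $\mathbb{R}^2$ such that, with $s=\lfloor\alpha\rfloor$: (i) $f_A$ is $s$-times continuously differentiable in $U_{r_A}(a)=\{b\in\mathbb{R}^2:|a-b|<r_A\}$ and $$\Big|\frac{\partial^sf_A}{\partial x^k\partial y^{s-k}}(x,y)-\frac{\partial^sf_A}{\partial x^k\partial y^{s-k}}(a_0,a_1)\Big|\le c_A\,|(x,y)-a|^{\alpha-s}$$ for all $k=0,\dots,s$ and $(x,y)\in U_{r_A}(a)$; (ii) $\psi_A$ is weakly differentiable with weak gradient satisfying $\int_{\mathbb{R}}\operatorname{ess\,sup}_{y\in\mathbb{R}}|\nabla\psi_A(x,y)|\,dx\le c_B$; (iii) $f_A(b)\le c_M$ for all $b\in\mathbb{R}^2$.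 *)

theory Defs
  imports "HOL-Probability.Probability"
begin

section \<open>Differentiability of functions on the plane\<close>

text \<open>Meaningful only where the respective partial derivative exists.\<close>

definition pderiv1 :: "(real \<times> real \<Rightarrow> real) \<Rightarrow> real \<times> real \<Rightarrow> real" where
  "pderiv1 f = (\<lambda>(x, y). deriv (\<lambda>t. f (t, y)) x)"

definition pderiv2 :: "(real \<times> real \<Rightarrow> real) \<Rightarrow> real \<times> real \<Rightarrow> real" where
  "pderiv2 f = (\<lambda>(x, y). deriv (\<lambda>t. f (x, t)) y)"

definition partially_differentiable_at :: "(real \<times> real \<Rightarrow> real) \<Rightarrow> real \<times> real \<Rightarrow> bool" where
  "partially_differentiable_at f = (\<lambda>(x, y).
     (\<lambda>t. f (t, y)) field_differentiable at x \<and> (\<lambda>t. f (x, t)) field_differentiable at y)"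

text \<open>Intended for open \<open>U\<close> only: the derivatives are two-sided.\<close>

primrec cont_differentiable_on ::
  "nat \<Rightarrow> (real \<times> real \<Rightarrow> real) \<Rightarrow> (real \<times> real) set \<Rightarrow> bool" where
  "cont_differentiable_on 0 f U \<longleftrightarrow> continuous_on U f"
| "cont_differentiable_on (Suc k) f U \<longleftrightarrow>
     (\<forall>p\<in>U. partially_differentiable_at f p) \<and>
     cont_differentiable_on k (pderiv1 f) U \<and> cont_differentiable_on k (pderiv2 f) U"

definition test_function :: "(real \<times> real \<Rightarrow> real) \<Rightarrow> bool" where
  "test_function \<phi> \<longleftrightarrow>
     (\<forall>k. cont_differentiable_on k \<phi> UNIV) \<and> compact (closure {p. \<phi> p \<noteq> 0})"

definition locally_integrable ::
  "(real \<times> real \<Rightarrow> 'b::{banach, second_countable_topology}) \<Rightarrow> bool" where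
  "locally_integrable g \<longleftrightarrow> (\<forall>K. compact K \<longrightarrow> set_integrable lborel K g)"

definition weak_gradient ::
  "(real \<times> real \<Rightarrow> complex) \<Rightarrow> (real \<times> real \<Rightarrow> complex \<times> complex) \<Rightarrow> bool" where
  "weak_gradient u g \<longleftrightarrow> locally_integrable u \<and> locally_integrable g \<and>
     (\<forall>\<phi>. test_function \<phi> \<longrightarrow>
        (LINT p|lborel. pderiv1 \<phi> p *\<^sub>R u p) = - (LINT p|lborel. \<phi> p *\<^sub>R fst (g p)) \<and>
        (LINT p|lborel. pderiv2 \<phi> p *\<^sub>R u p) = - (LINT p|lborel. \<phi> p *\<^sub>R snd (g p)))"


section \<open>The random coefficient regression model\<close>

definition prob_density :: "('a::euclidean_space \<Rightarrow> real) \<Rightarrow> bool" where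
  "prob_density f \<longleftrightarrow> f \<in> borel_measurable borel \<and> (\<forall>x. 0 \<le> f x) \<and>
     (\<integral>\<^sup>+x. ennreal (f x) \<partial>lborel) = 1"

definition law_of_density :: "('a::euclidean_space \<Rightarrow> real) \<Rightarrow> 'a measure" where
  "law_of_density f = density lborel (\<lambda>x. ennreal (f x))"

text \<open>The canonical probability space carrying the sequence of pairs \<open>(X\<^sub>j, A\<^sub>j)\<close>: these are
  i.i.d., with \<open>X\<^sub>j\<close> and \<open>A\<^sub>j\<close> independent with densities \<open>f\<^sub>X\<close> and \<open>f\<^sub>A\<close>. The indices \<open>j\<close> start at 0.\<close>

type_synonym sample_point = "nat \<Rightarrow> real \<times> (real \<times> real)"

definition rcr_space :: "(real \<Rightarrow> real) \<Rightarrow> (real \<times> real \<Rightarrow> real) \<Rightarrow> sample_point measure" where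
  "rcr_space f\<^sub>X f\<^sub>A = (\<Pi>\<^sub>M j\<in>UNIV. law_of_density f\<^sub>X \<Otimes>\<^sub>M law_of_density f\<^sub>A)"

definition design :: "nat \<Rightarrow> sample_point \<Rightarrow> real" where
  "design j \<omega> = fst (\<omega> j)"

definition coefficients :: "nat \<Rightarrow> sample_point \<Rightarrow> real \<times> real" where
  "coefficients j \<omega> = snd (\<omega> j)"

definition response :: "nat \<Rightarrow> sample_point \<Rightarrow> real" where
  "response j \<omega> = fst (coefficients j \<omega>) + snd (coefficients j \<omega>) * design j \<omega>"

definition observations :: "nat \<Rightarrow> sample_point \<Rightarrow> nat \<Rightarrow> real \<times> real" where
  "observations n \<omega> = (\<lambda>j\<in>{..<n}. (design j \<omega>, response j \<omega>))"

text \<open>An estimator maps the data \<open>(X\<^sub>j, Y\<^sub>j)\<close>, \<open>j < n\<close>, to a function on the plane each of whose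
  values is a real random variable; the estimate need not itself be a density.\<close>

definition estimator ::
  "nat \<Rightarrow> ((nat \<Rightarrow> real \<times> real) \<Rightarrow> real \<times> real \<Rightarrow> real) \<Rightarrow> bool" where
  "estimator n fhat \<longleftrightarrow> (\<forall>b. (\<lambda>d. fhat d b) \<in> borel_measurable (\<Pi>\<^sub>M j\<in>{..<n}. borel))"

text \<open>The risk takes the value \<open>\<infinity>\<close> if the squared error is not integrable.\<close>

definition pointwise_risk ::
  "(real \<Rightarrow> real) \<Rightarrow> (real \<times> real \<Rightarrow> real) \<Rightarrow> nat \<Rightarrow>
   ((nat \<Rightarrow> real \<times> real) \<Rightarrow> real \<times> real \<Rightarrow> real) \<Rightarrow> real \<times> real \<Rightarrow> ennreal" where
  "pointwise_risk f\<^sub>X f\<^sub>A n fhat b =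
     (\<integral>\<^sup>+\<omega>. ennreal (\<bar>fhat (observations n \<omega>) b - f\<^sub>A b\<bar>\<^sup>2) \<partial>rcr_space f\<^sub>X f\<^sub>A)"


section \<open>The class of coefficient densities\<close>

definition char_fun :: "(real \<times> real \<Rightarrow> real) \<Rightarrow> real \<times> real \<Rightarrow> complex" where
  "char_fun f\<^sub>A b = (LINT a|law_of_density f\<^sub>A. exp (\<i> * complex_of_real (b \<bullet> a)))"

text \<open>The largest integer strictly less than \<open>\<alpha>\<close>, for \<open>\<alpha> > 0\<close>; differs from \<open>\<lfloor>\<alpha>\<rfloor>\<close> at integers.\<close>

definition strict_floor :: "real \<Rightarrow> nat" where
  "strict_floor \<alpha> = Max {k. real k < \<alpha>}"

text \<open>The weak gradient is determined up to a null set, which affects neither the essential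
  supremum (for almost every \<open>x\<close>) nor the integral below.\<close>

definition coeff_class ::
  "real \<times> real \<Rightarrow> real \<Rightarrow> real \<Rightarrow> real \<Rightarrow> real \<Rightarrow> real \<Rightarrow> (real \<times> real \<Rightarrow> real) set" where
  "coeff_class a \<alpha> c\<^sub>A c\<^sub>B r\<^sub>A c\<^sub>M = {f. prob_density f \<and>
     (let s = strict_floor \<alpha> in
        cont_differentiable_on s f (ball a r\<^sub>A) \<and>
        (\<forall>k\<le>s. \<forall>p\<in>ball a r\<^sub>A.
           \<bar>(pderiv1 ^^ k) ((pderiv2 ^^ (s - k)) f) p - (pderiv1 ^^ k) ((pderiv2 ^^ (s - k)) f) a\<bar>
             \<le> c\<^sub>A * norm (p - a) powr (\<alpha> - real s))) \<and>
     (\<exists>g. weak_gradient (char_fun f) g \<and>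
        (\<integral>\<^sup>+x. esssup lborel (\<lambda>y. ennreal (norm (g (x, y)))) \<partial>lborel) \<le> ennreal c\<^sub>B) \<and>
     (\<forall>b. f b \<le> c\<^sub>M)}"

end

theory Submission
  imports Defs
begin

text \<open>
The lower bound rests on two coefficient densities in the class which no sample can tell apart
unless it contains an exceptionally large design point.

Given \<open>X = x\<close>, the response \<open>A\<^sub>0 + A\<^sub>1 x\<close> has the characteristic function \<open>t \<mapsto> \<psi>\<^sub>A (t, t x)\<close>. If two
characteristic functions coincide on the cone \<open>\<bar>b\<^sub>1\<bar> \<le> R \<bar>b\<^sub>0\<bar>\<close>, then for \<open>\<bar>x\<bar> \<le> R\<close> both densities give
exactly the same conditional law of the response (\<open>char_fun_coeff_density_agree\<close>,
\<open>response_law_eq\<close>). On the event that all \<open>n\<close> design points lie in \<open>[- R, R]\<close> the data then carry no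
information, and the two-point argument \<open>two_point_risk_bound\<close> bounds the sum of the two risks from
below by half the squared difference of the densities at \<open>0\<close> times the probability of this event. Under the
tail condition a single design point exceeds \<open>R\<close> in absolute value with probability of order
\<open>R\<^sup>-\<^sup>(\<^sup>\<beta>\<^sup>+\<^sup>1\<^sup>)\<close>, so that \<open>R = n\<^sup>1\<^sup>/\<^sup>(\<^sup>\<beta>\<^sup>+\<^sup>1\<^sup>)\<close> keeps the probability of the event away from \<open>0\<close>.

The densities are products, built from the Fejer density \<open>k (x) = (1 - cos x) / (\<pi> x\<^sup>2)\<close>, whose
characteristic function is the tent \<open>max 0 (1 - \<bar>t\<bar>)\<close>. The first is \<open>k \<otimes> k\<close>; in the second, the slope
factor is multiplied by \<open>1 + cos (2 y)\<close>, which doubles the value at \<open>0\<close>, keeps the density nonnegative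
and changes the characteristic function only where \<open>\<bar>b\<^sub>0\<bar> < 1\<close> and \<open>1 < \<bar>b\<^sub>1\<bar> < 3\<close>, hence outside the cone
\<open>\<bar>b\<^sub>1\<bar> \<le> \<bar>b\<^sub>0\<bar>\<close>.

Both are then dilated by \<open>1 / \<sigma>\<close> in the intercept and contracted by \<open>\<tau>\<close> in the slope, which widens
the cone to \<open>R = \<tau> / \<sigma>\<close> and scales the values by \<open>\<sigma> \<tau>\<close>. The gradient condition is invariant under the
first dilation up to a term of order \<open>\<sigma> / \<tau>\<close> (\<open>char_fun_gradient_bound\<close>), so it allows \<open>\<sigma> \<rightarrow> 0\<close>. The Hoelder
condition of order \<open>\<alpha>\<close> asks for \<open>\<sigma> \<tau>\<^sup>1\<^sup>+\<^sup>\<alpha> \<le> 1\<close> (\<open>scaled_deriv_hoelder\<close>). With equality, \<open>R = \<tau>\<^sup>\<alpha>\<^sup>+\<^sup>2\<close> and the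
densities differ at \<open>0\<close> by a multiple of \<open>\<tau>\<^sup>-\<^sup>\<alpha>\<close>. Expressed in \<open>n\<close>, the squared difference is of order
\<open>n\<close> to the power \<open>- 2 \<alpha> / ((\<alpha> + 2) (\<beta> + 1))\<close>. As the densities tend to \<open>0\<close> uniformly and their Hoelder
bound is global, the bound \<open>c\<^sub>M\<close> and the radius \<open>r\<^sub>A\<close> may be arbitrarily small.
\<close>

section \<open>The Fejer density and its smoothness\<close>

text \<open>The \<open>j\<close>-th derivative of \<open>x \<mapsto> \<integral>\<^sub>0\<^sup>1 (1 - t) cos ((t + c) x) dt\<close>. Shifting the phase by \<open>j \<pi> / 2\<close>
differentiates the cosine \<open>j\<close> times, so one formula covers all orders.\<close>

definition cos_moment :: "real \<Rightarrow> nat \<Rightarrow> real \<Rightarrow> real" where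
  "cos_moment c j x =
     integral {0..1} (\<lambda>t. (1 - t) * (t + c) ^ j * cos ((t + c) * x + real j * (pi / 2)))"

lemma cos_moment_deriv: "(cos_moment c j has_real_derivative cos_moment c (Suc j) x) (at x)"
proof -
  have cosS: "cos (z + real (Suc j) * (pi / 2)) = - sin (z + real j * (pi / 2))" for z
  proof -
    have "z + real (Suc j) * (pi / 2) = (z + real j * (pi / 2)) + pi / 2"
      by (simp add: algebra_simps)
    then show ?thesis by (metis cos_add cos_pi_half sin_pi_half mult_zero_right mult_1_right diff_0)
  qed
  let ?f = "\<lambda>x t. (1 - t) * (t + c) ^ j * cos ((t + c) * x + real j * (pi / 2))"
  let ?g = "\<lambda>x t. (1 - t) * (t + c) ^ Suc j * cos ((t + c) * x + real (Suc j) * (pi / 2))"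
  have "((\<lambda>x. integral (cbox 0 1) (?f x)) has_field_derivative integral (cbox 0 1) (?g x))
          (at x within UNIV)"
  proof (rule leibniz_rule_field_derivative)
    show "((\<lambda>x. ?f x t) has_field_derivative ?g y t) (at y within UNIV)" for y t
      unfolding cosS by (auto intro!: derivative_eq_intros)
    show "?f y integrable_on cbox 0 1" for y
      by (intro integrable_continuous continuous_intros)
    show "continuous_on (UNIV \<times> cbox 0 1) (\<lambda>(x, t). ?g x t)"
      unfolding split_beta by (intro continuous_intros)
  qed auto
  then show ?thesis
    by (simp add: cos_moment_def[abs_def] del: of_nat_Suc power_Suc)
qed

lemma abs_cos_moment_le:
  assumes "\<bar>c\<bar> \<le> 2" shows "\<bar>cos_moment c j x\<bar> \<le> 3 ^ j"
proof -
  have "norm (integral (cbox 0 1)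
      (\<lambda>t::real. (1 - t) * (t + c) ^ j * cos ((t + c) * x + real j * (pi / 2))))
    \<le> integral (cbox 0 1) (\<lambda>t::real. (3::real) ^ j)"
  proof (rule integral_norm_bound_integral)
    show "(\<lambda>t. (1 - t) * (t + c) ^ j * cos ((t + c) * x + real j * (pi / 2))) integrable_on cbox 0 1"
      by (intro integrable_continuous continuous_intros)
    fix t :: real assume t: "t \<in> cbox 0 1"
    have "norm ((1 - t) * (t + c) ^ j * cos ((t + c) * x + real j * (pi / 2)))
        = \<bar>1 - t\<bar> * \<bar>t + c\<bar> ^ j * \<bar>cos ((t + c) * x + real j * (pi / 2))\<bar>"
      by (simp add: abs_mult power_abs)
    also have "\<dots> \<le> 1 * 3 ^ j * 1"
      using t assms by (intro mult_mono power_mono) auto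
    finally show "norm ((1 - t) * (t + c) ^ j * cos ((t + c) * x + real j * (pi / 2))) \<le> 3 ^ j"
      by simp
  qed auto
  then show ?thesis by (simp add: cos_moment_def)
qed

text \<open>The value at \<open>0\<close> is the continuous extension.\<close>

definition fejer :: "real \<Rightarrow> real" where
  "fejer x = (if x = 0 then 1 / 2 else (1 - cos x) / x\<^sup>2)"

text \<open>The Fejer kernel is the cosine transform of \<open>1 - t\<close> on the unit interval, and the addition theorem
turns a modulation by \<open>cos (c x)\<close> into a shift of the frequency \<open>t\<close> by \<open>c\<close> and by \<open>- c\<close>. Through this
representation all derivatives of the kernel and of its modulations are bounded functions.\<close>

lemma cos_moment_0: "cos_moment c 0 x + cos_moment (- c) 0 x = 2 * (cos (c * x) * fejer x)"
proof -
  have fej: "((\<lambda>t. (1 - t) * cos (t * x)) has_integral fejer x) {0..1}"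
  proof (cases "x = 0")
    case True
    have "((\<lambda>t::real. 1 - t) has_integral (1 - 1\<^sup>2 / 2) - (0 - 0\<^sup>2 / 2)) {0..1}"
      by (rule fundamental_theorem_of_calculus)
        (auto intro!: derivative_eq_intros simp: has_real_derivative_iff_has_vector_derivative[symmetric])
    with True show ?thesis by (simp add: fejer_def)
  next
    case False
    let ?F = "\<lambda>t. (1 - t) * sin (t * x) / x - cos (t * x) / x\<^sup>2"
    have "((\<lambda>t. (1 - t) * cos (t * x)) has_integral ?F 1 - ?F 0) {0..1}"
      using False by (intro fundamental_theorem_of_calculus)
        (auto intro!: derivative_eq_intros
           simp: has_real_derivative_iff_has_vector_derivative[symmetric] field_simps power2_eq_square)
    with False show ?thesis by (simp add: fejer_def diff_divide_distrib)
  qed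
  have *: "(\<lambda>t. (1 - t) * cos ((t + c) * x)) integrable_on {0..1}" for c
    by (intro integrable_continuous_interval continuous_intros)
  have "cos_moment c 0 x + cos_moment (- c) 0 x
      = integral {0..1} (\<lambda>t. (1 - t) * cos ((t + c) * x) + (1 - t) * cos ((t + - c) * x))"
    by (subst integral_add[OF * *]) (simp add: cos_moment_def)
  also have "\<dots> = integral {0..1} (\<lambda>t. 2 * cos (c * x) * ((1 - t) * cos (t * x)))"
    by (rule arg_cong[where f = "integral _"])
      (auto simp: algebra_simps cos_add cos_diff)
  also have "\<dots> = 2 * cos (c * x) * fejer x"
    using has_integral_mult_right[OF fej] by (rule integral_unique)
  finally show ?thesis by simp
qed

lemma fejer_nonneg: "0 \<le> fejer x"
  by (simp add: fejer_def)

lemma fejer_minus: "fejer (- x) = fejer x"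
  by (simp add: fejer_def)

lemma fejer_measurable [measurable]: "fejer \<in> borel_measurable borel"
  unfolding fejer_def[abs_def] by measurable

lemma one_minus_cos_le: "1 - cos x \<le> x\<^sup>2 / (2::real)"
proof -
  have "1 - cos x = 2 * (sin (x / 2))\<^sup>2"
    using cos_double_sin[of "x / 2"] by simp
  also have "(sin (x / 2))\<^sup>2 \<le> (x / 2)\<^sup>2"
    using abs_sin_x_le_abs_x by (metis power2_abs power_mono abs_ge_zero)
  finally show ?thesis by (simp add: power2_eq_square)
qed

lemma fejer_le: "fejer x \<le> 3 * inverse (1 + x\<^sup>2)"
proof (cases "x = 0")
  case False
  have "1 - cos x \<le> 2" using cos_ge_minus_one[of x] by linarith
  then have "(1 - cos x) * x\<^sup>2 \<le> 2 * x\<^sup>2" by (intro mult_right_mono) auto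
  then have "(1 - cos x) * (1 + x\<^sup>2) \<le> 3 * x\<^sup>2"
  proof -
    have "(1 - cos x) * (1 + x\<^sup>2) = (1 - cos x) + (1 - cos x) * x\<^sup>2"
      by (simp add: distrib_left)
    also have "\<dots> \<le> x\<^sup>2 / 2 + 2 * x\<^sup>2"
      using one_minus_cos_le[of x] \<open>(1 - cos x) * x\<^sup>2 \<le> 2 * x\<^sup>2\<close> by (rule add_mono)
    also have "\<dots> \<le> 3 * x\<^sup>2" by simp
    finally show ?thesis .
  qed
  moreover have "0 < 1 + x\<^sup>2" by (simp add: add_pos_nonneg)
  ultimately show ?thesis using False by (simp add: fejer_def field_simps)
qed (simp add: fejer_def)

lemma fejer_integrable: "integrable lborel fejer"
proof (rule Bochner_Integration.integrable_bound)
  show "integrable lborel (\<lambda>x::real. 3 * inverse (1 + x\<^sup>2))"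
    using integrable_inverse_1_plus_square by (simp add: set_integrable_def)
qed (auto simp: fejer_nonneg fejer_le intro!: order_trans[OF fejer_le] AE_I2)

definition fejer_mass :: real where "fejer_mass = (LINT x|lborel. fejer x)"

lemma fejer_mass_pos: "fejer_mass > 0"
proof -
  have "fejer_mass \<noteq> 0"
  proof
    assume "fejer_mass = 0"
    then have "AE x in lborel. fejer x = 0"
      unfolding fejer_mass_def
      by (subst (asm) integral_nonneg_eq_0_iff_AE[OF fejer_integrable]) (auto simp: fejer_nonneg)
    then have "emeasure lborel {x. fejer x \<noteq> 0} = 0"
      by (subst (asm) AE_iff_measurable[OF _ refl]) auto
    moreover have "{0<..<1} \<subseteq> {x. fejer x \<noteq> 0}"
    proof
      fix x :: real assume x: "x \<in> {0<..<1}"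
      have "cos x < cos 0" using x pi_gt3 by (intro cos_monotone_0_pi) auto
      then show "x \<in> {x. fejer x \<noteq> 0}" using x by (simp add: fejer_def)
    qed
    ultimately have "emeasure lborel {0<..<1::real} = 0"
      using emeasure_mono[of "{0<..<1}" "{x. fejer x \<noteq> 0}" lborel] by simp
    then show False by simp
  qed
  moreover have "fejer_mass \<ge> 0"
    unfolding fejer_mass_def by (rule Bochner_Integration.integral_nonneg) (simp add: fejer_nonneg)
  ultimately show ?thesis by simp
qed

text \<open>The value at \<open>0\<close> is again the continuous extension; with it the function is a rescaled Fejer kernel
at every point.\<close>

definition osc_integrand :: "real \<Rightarrow> real \<Rightarrow> real" where
  "osc_integrand a x = (if x = 0 then a\<^sup>2 / 2 else (1 - cos (a * x)) / x\<^sup>2)"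

text \<open>Substituting \<open>a x\<close> for \<open>x\<close> shows that the integral is proportional to \<open>\<bar>a\<bar>\<close>; the constant, whose value
is \<open>\<pi>\<close>, never has to be computed, because the kernel is normalised by its total mass.\<close>

lemma has_integral_osc:
  "has_bochner_integral lborel (osc_integrand a) (\<bar>a\<bar> * fejer_mass)"
proof (cases "a = 0")
  case True
  then have "osc_integrand a = (\<lambda>_. 0)" by (auto simp: osc_integrand_def)
  with True show ?thesis by (simp add: has_bochner_integral_zero)
next
  case False
  have eq: "osc_integrand a x = a\<^sup>2 * fejer (0 + a * x)" for x
    using False by (auto simp: osc_integrand_def fejer_def power_mult_distrib)
  have "integrable lborel (\<lambda>x. fejer (0 + a * x))"
    using fejer_integrable False by (rule lborel_integrable_real_affine)
  moreover have "(LINT x|lborel. fejer (0 + a * x)) = fejer_mass / \<bar>a\<bar>"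
    using lborel_integral_real_affine[of a fejer 0] False by (simp add: fejer_mass_def)
  ultimately have "has_bochner_integral lborel (\<lambda>x. a\<^sup>2 * fejer (0 + a * x)) (a\<^sup>2 * (fejer_mass / \<bar>a\<bar>))"
    by (intro has_bochner_integral_mult_right) (simp add: has_bochner_integral_iff)
  moreover have "a\<^sup>2 * (fejer_mass / \<bar>a\<bar>) = \<bar>a\<bar> * fejer_mass"
    using False by (simp add: field_simps power2_eq_square)
  ultimately show ?thesis by (simp add: eq[abs_def])
qed

section \<open>Band-limited characteristic functions\<close>

text \<open>This is \<open>max 0 (1 - \<bar>t\<bar>)\<close>, written as a combination of absolute values because that is the form in
which it appears as a Fourier transform.\<close>

definition tent :: "real \<Rightarrow> real" where
  "tent t = (\<bar>1 + t\<bar> + \<bar>1 - t\<bar>) / 2 - \<bar>t\<bar>"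

text \<open>The product \<open>(1 - cos x) cos (t x)\<close> is a linear combination of \<open>1 - cos (a x)\<close> with \<open>a = 1 + t\<close>,
\<open>a = 1 - t\<close> and \<open>a = t\<close>, and each of these integrates against \<open>1 / x\<^sup>2\<close> to a multiple of \<open>\<bar>a\<bar>\<close>.\<close>

lemma has_integral_fejer_cos:
  "has_bochner_integral lborel (\<lambda>x. fejer x * cos (t * x)) (tent t * fejer_mass)"
proof -
  have eq: "fejer x * cos (t * x)
      = (1/2) * osc_integrand (1 + t) x + (1/2) * osc_integrand (1 - t) x - osc_integrand t x" for x
  proof (cases "x = 0")
    case True then show ?thesis
      by (simp add: fejer_def osc_integrand_def power2_eq_square field_simps)
  next
    case False
    have "cos ((1 + t) * x) + cos ((1 - t) * x) = 2 * (cos x * cos (t * x))"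
      by (simp add: distrib_right left_diff_distrib cos_add cos_diff)
    with False show ?thesis
      by (simp add: fejer_def osc_integrand_def divide_simps) (simp add: algebra_simps)
  qed
  have "has_bochner_integral lborel (\<lambda>x. fejer x * cos (t * x))
     ((1/2) * (\<bar>1 + t\<bar> * fejer_mass) + (1/2) * (\<bar>1 - t\<bar> * fejer_mass) - \<bar>t\<bar> * fejer_mass)"
    unfolding eq[abs_def]
    by (intro has_bochner_integral_add has_bochner_integral_diff has_bochner_integral_mult_right
        has_integral_osc)
  then show ?thesis by (simp add: tent_def algebra_simps add_divide_distrib)
qed

lemma integrable_fejer_mult:
  assumes [measurable]: "g \<in> borel_measurable borel" and "\<And>x. \<bar>g x\<bar> \<le> B"
  shows "integrable lborel (\<lambda>x. fejer x * g x)"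
proof (rule Bochner_Integration.integrable_bound)
  show "integrable lborel (\<lambda>x. B * fejer x)" using fejer_integrable by simp
  show "AE x in lborel. norm (fejer x * g x) \<le> norm (B * fejer x)"
  proof (rule AE_I2)
    fix x
    have "\<bar>fejer x * g x\<bar> = \<bar>g x\<bar> * fejer x" by (simp add: abs_mult fejer_nonneg)
    also have "\<dots> \<le> B * fejer x" using assms(2) fejer_nonneg by (intro mult_right_mono) auto
    also have "\<dots> \<le> \<bar>B * fejer x\<bar>" by simp
    finally show "norm (fejer x * g x) \<le> norm (B * fejer x)" by simp
  qed
qed measurable

lemma has_integral_fejer_sin:
  "has_bochner_integral lborel (\<lambda>x. fejer x * sin (t * x)) 0"
proof -
  have "integrable lborel (\<lambda>x. fejer x * sin (t * x))"
    by (rule integrable_fejer_mult[where B = 1]) auto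
  moreover have "(LINT x|lborel. fejer x * sin (t * x)) = 0"
    using lborel_integral_real_affine[of "-1" "\<lambda>x. fejer x * sin (t * x)" 0]
    by (simp add: fejer_minus)
  ultimately show ?thesis by (simp add: has_bochner_integral_iff)
qed

lemma has_integral_fejer_iexp:
  "has_bochner_integral lborel (\<lambda>x. complex_of_real (fejer x) * iexp (t * x))
     (complex_of_real (tent t * fejer_mass))"
proof -
  have "has_bochner_integral lborel
      (\<lambda>x. complex_of_real (fejer x * cos (t * x)) + \<i> * complex_of_real (fejer x * sin (t * x)))
      (complex_of_real (tent t * fejer_mass) + \<i> * complex_of_real 0)"
    by (intro has_bochner_integral_add has_bochner_integral_mult_right
        has_bochner_integral_of_real has_integral_fejer_cos has_integral_fejer_sin)
  moreover have "complex_of_real (fejer x) * iexp (t * x)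
      = complex_of_real (fejer x * cos (t * x)) + \<i> * complex_of_real (fejer x * sin (t * x))" for x
    by (simp add: exp_Euler cos_of_real sin_of_real algebra_simps flip: of_real_mult)
  ultimately show ?thesis by simp
qed

text \<open>For \<open>\<epsilon> = 0\<close> this is the Fejer density; for \<open>\<epsilon> = 1\<close> its value at \<open>0\<close> is doubled. The modulation
changes the characteristic function only at frequencies between \<open>1\<close> and \<open>3\<close> in absolute value, so the
total mass stays equal to \<open>1\<close>.\<close>

definition band_density :: "real \<Rightarrow> real \<Rightarrow> real" where
  "band_density \<epsilon> x = fejer x * (1 + \<epsilon> * cos (2 * x)) / fejer_mass"

text \<open>The characteristic function of \<open>band_density \<epsilon>\<close>.\<close>

definition band_char :: "real \<Rightarrow> real \<Rightarrow> real" where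
  "band_char \<epsilon> t = tent t + \<epsilon> / 2 * (tent (t + 2) + tent (t - 2))"

lemma has_integral_band_density_iexp:
  "has_bochner_integral lborel (\<lambda>x. complex_of_real (band_density \<epsilon> x) * iexp (t * x))
     (complex_of_real (band_char \<epsilon> t))"
proof -
  have eq: "complex_of_real (band_density \<epsilon> x) * iexp (t * x) =
      (complex_of_real (fejer x) * iexp (t * x)
        + complex_of_real (\<epsilon> / 2) * (complex_of_real (fejer x) * iexp ((t + 2) * x)
                                  + complex_of_real (fejer x) * iexp ((t - 2) * x)))
        / complex_of_real fejer_mass" for x
  proof -
    have "iexp ((t + 2) * x) + iexp ((t - 2) * x) = 2 * complex_of_real (cos (2 * x)) * iexp (t * x)"
      by (simp add: distrib_right left_diff_distrib complex_eq_iff Re_exp Im_exp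
          cos_add cos_diff sin_add sin_diff)
    then have "complex_of_real (fejer x) * iexp ((t + 2) * x)
        + complex_of_real (fejer x) * iexp ((t - 2) * x)
        = complex_of_real (fejer x) * (2 * complex_of_real (cos (2 * x)) * iexp (t * x))"
      by (simp only: distrib_left[symmetric])
    then show ?thesis
      by (simp add: band_density_def) (simp add: algebra_simps)
  qed
  have "has_bochner_integral lborel (\<lambda>x. complex_of_real (band_density \<epsilon> x) * iexp (t * x))
     ((complex_of_real (tent t * fejer_mass)
        + complex_of_real (\<epsilon> / 2) * (complex_of_real (tent (t + 2) * fejer_mass)
                                  + complex_of_real (tent (t - 2) * fejer_mass)))
        / complex_of_real fejer_mass)"
    unfolding eq[abs_def]
    by (intro has_bochner_integral_divide has_bochner_integral_add has_bochner_integral_mult_right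
        has_integral_fejer_iexp)
  moreover have "(complex_of_real (tent t * fejer_mass)
        + complex_of_real (\<epsilon> / 2) * (complex_of_real (tent (t + 2) * fejer_mass)
                                  + complex_of_real (tent (t - 2) * fejer_mass)))
        / complex_of_real fejer_mass = complex_of_real (band_char \<epsilon> t)"
    using fejer_mass_pos by (simp add: band_char_def field_simps)
  ultimately show ?thesis by simp
qed

lemma tent_eq_0: "\<bar>t\<bar> \<ge> 1 \<Longrightarrow> tent t = 0"
  by (auto simp: tent_def abs_if split: if_splits)

lemma tent_bounds: "0 \<le> tent t" "tent t \<le> 1"
  by (auto simp: tent_def abs_if)

lemma band_density_nonneg: "\<bar>\<epsilon>\<bar> \<le> 1 \<Longrightarrow> 0 \<le> band_density \<epsilon> x"
proof -
  assume "\<bar>\<epsilon>\<bar> \<le> 1"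
  then have "\<bar>\<epsilon> * cos (2 * x)\<bar> \<le> 1 * 1"
    unfolding abs_mult by (intro mult_mono) auto
  then have "0 \<le> 1 + \<epsilon> * cos (2 * x)" by (simp add: abs_le_iff)
  then show ?thesis using fejer_mass_pos fejer_nonneg by (simp add: band_density_def)
qed

lemma band_density_measurable [measurable]: "band_density \<epsilon> \<in> borel_measurable borel"
  unfolding band_density_def[abs_def] by measurable

lemma band_char_0: "band_char \<epsilon> 0 = 1"
  by (simp add: band_char_def tent_def)

lemma prob_density_band_density:
  assumes "\<bar>\<epsilon>\<bar> \<le> 1" shows "prob_density (band_density \<epsilon>)"
proof -
  have "has_bochner_integral lborel (\<lambda>x. complex_of_real (band_density \<epsilon> x)) 1"
    using has_integral_band_density_iexp[of \<epsilon> 0] by (simp add: band_char_0)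
  then have "has_bochner_integral lborel (\<lambda>x. Re (complex_of_real (band_density \<epsilon> x))) (Re 1)"
    by (rule has_bochner_integral_Re)
  then have "has_bochner_integral lborel (band_density \<epsilon>) 1" by simp
  then show ?thesis
    using assms
    by (simp add: prob_density_def band_density_nonneg has_bochner_integral_iff nn_integral_eq_integral)
qed

definition band_density_deriv :: "real \<Rightarrow> nat \<Rightarrow> real \<Rightarrow> real" where
  "band_density_deriv \<epsilon> j x =
     (cos_moment 0 j x + \<epsilon> / 2 * (cos_moment 2 j x + cos_moment (- 2) j x)) / fejer_mass"

lemma band_density_deriv_0: "band_density_deriv \<epsilon> 0 = band_density \<epsilon>"
proof
  fix x show "band_density_deriv \<epsilon> 0 x = band_density \<epsilon> x"
    using cos_moment_0[of 0 x] cos_moment_0[of 2 x]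
    by (simp add: band_density_deriv_def band_density_def algebra_simps)
qed

lemma band_density_deriv_Suc:
  "(band_density_deriv \<epsilon> j has_real_derivative band_density_deriv \<epsilon> (Suc j) x) (at x)"
  unfolding band_density_deriv_def[abs_def] using fejer_mass_pos
  by (auto intro!: derivative_eq_intros cos_moment_deriv)

lemma abs_band_density_deriv_le:
  assumes "\<bar>\<epsilon>\<bar> \<le> 1" shows "\<bar>band_density_deriv \<epsilon> j x\<bar> \<le> 2 * 3 ^ j / fejer_mass"
proof -
  have "\<bar>cos_moment 0 j x + \<epsilon> / 2 * (cos_moment 2 j x + cos_moment (- 2) j x)\<bar>
      \<le> \<bar>cos_moment 0 j x\<bar> + \<bar>\<epsilon>\<bar> / 2 * (\<bar>cos_moment 2 j x\<bar> + \<bar>cos_moment (- 2) j x\<bar>)"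
    by (intro order_trans[OF abs_triangle_ineq] add_mono) (auto simp: abs_mult intro!: mult_left_mono)
  also have "\<dots> \<le> 3 ^ j + 1 / 2 * (3 ^ j + 3 ^ j)"
    using assms by (intro add_mono mult_mono abs_cos_moment_le) auto
  finally show ?thesis
    using fejer_mass_pos by (simp add: band_density_deriv_def divide_right_mono)
qed

section \<open>Smoothness of product densities\<close>

definition tensor :: "(real \<Rightarrow> real) \<Rightarrow> (real \<Rightarrow> real) \<Rightarrow> real \<times> real \<Rightarrow> real" where
  "tensor g h = (\<lambda>(x, y). g x * h y)"

context
  fixes G H :: "nat \<Rightarrow> real \<Rightarrow> real"
  assumes G: "\<And>j x. (G j has_real_derivative G (Suc j) x) (at x)"
    and H: "\<And>j x. (H j has_real_derivative H (Suc j) x) (at x)"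
begin

lemma pderiv1_tensor: "pderiv1 (tensor (G i) (H j)) = tensor (G (Suc i)) (H j)"
  using G by (auto simp: pderiv1_def tensor_def fun_eq_iff intro!: DERIV_imp_deriv derivative_eq_intros)

lemma pderiv2_tensor: "pderiv2 (tensor (G i) (H j)) = tensor (G i) (H (Suc j))"
  using H by (auto simp: pderiv2_def tensor_def fun_eq_iff intro!: DERIV_imp_deriv derivative_eq_intros)

lemma pderiv1_pderiv2_power_tensor:
  "(pderiv1 ^^ k) ((pderiv2 ^^ l) (tensor (G i) (H j))) = tensor (G (k + i)) (H (l + j))"
proof -
  have "(pderiv2 ^^ l) (tensor (G i) (H j)) = tensor (G i) (H (l + j))"
    by (induction l) (auto simp: pderiv2_tensor)
  moreover have "(pderiv1 ^^ k) (tensor (G i) (H m)) = tensor (G (k + i)) (H m)" for m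
    by (induction k) (auto simp: pderiv1_tensor)
  ultimately show ?thesis by simp
qed

lemma cont_differentiable_on_tensor: "cont_differentiable_on k (tensor (G i) (H j)) U"
proof (induction k arbitrary: i j)
  case 0
  have "continuous_on UNIV (G i)" "continuous_on UNIV (H j)"
    using G H by (auto intro!: DERIV_continuous_on)
  then have "continuous_on U (\<lambda>p. G i (fst p) * H j (snd p))"
    by (intro continuous_on_mult continuous_on_compose2[OF _ continuous_on_fst[OF continuous_on_id]]
        continuous_on_compose2[OF _ continuous_on_snd[OF continuous_on_id]]) auto
  then show ?case by (simp add: tensor_def split_beta)
next
  case (Suc k)
  have "partially_differentiable_at (tensor (G i) (H j)) p" for p
    using G H unfolding partially_differentiable_at_def tensor_def field_differentiable_def
    by (auto split: prod.split intro!: exI derivative_eq_intros)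
  with Suc show ?case by (simp add: pderiv1_tensor pderiv2_tensor)
qed

end

text \<open>Interpolation between a bound and a Lipschitz bound: \<open>min 1 r \<le> r\<^sup>\<theta>\<close> for \<open>0 < \<theta> \<le> 1\<close>.\<close>

lemma le_powr_of_le_const_of_le_linear:
  fixes d B r \<theta> :: real
  assumes "d \<le> B" "d \<le> B * r" "0 \<le> r" "0 \<le> B" "0 < \<theta>" "\<theta> \<le> 1"
  shows "d \<le> B * r powr \<theta>"
proof (cases "r \<le> 1")
  case True
  have "r = r powr 1 \<or> r = 0" using assms by (cases "r = 0") auto
  then have "r \<le> r powr \<theta>"
  proof
    assume "r = r powr 1"
    have "r = 0 \<or> r powr 1 \<le> r powr \<theta>" using True assms powr_mono'[of \<theta> 1 r] by auto
    with \<open>r = r powr 1\<close> show ?thesis by auto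
  qed simp
  then have "B * r \<le> B * r powr \<theta>" using assms by (intro mult_left_mono) auto
  with assms show ?thesis by linarith
next
  case False
  then have "1 \<le> r powr \<theta>" using assms by (intro ge_one_powr_ge_zero) auto
  then have "B * 1 \<le> B * r powr \<theta>" using assms by (intro mult_left_mono) auto
  with assms show ?thesis by linarith
qed

lemma strict_floor_bounds:
  assumes "\<alpha> > 0" shows "real (strict_floor \<alpha>) < \<alpha>" "\<alpha> \<le> real (strict_floor \<alpha>) + 1"
proof -
  let ?S = "{k. real k < \<alpha>}"
  have "?S \<subseteq> {..nat \<lceil>\<alpha>\<rceil>}" by (auto simp: nat_le_iff) linarith+
  then have fin: "finite ?S" by (rule finite_subset) simp
  have "0 \<in> ?S" using assms by simp
  then have "?S \<noteq> {}" by blast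
  from Max_in[OF fin this] show "real (strict_floor \<alpha>) < \<alpha>" by (simp add: strict_floor_def)
  have "Suc (strict_floor \<alpha>) \<notin> ?S"
    using Max_ge[OF fin, of "Suc (strict_floor \<alpha>)"] unfolding strict_floor_def by auto
  then show "\<alpha> \<le> real (strict_floor \<alpha>) + 1" by simp
qed

definition scaled_density :: "real \<Rightarrow> real \<Rightarrow> real \<Rightarrow> real" where
  "scaled_density \<epsilon> \<sigma> = (\<lambda>x. \<sigma> * band_density \<epsilon> (\<sigma> * x))"

definition scaled_deriv :: "real \<Rightarrow> real \<Rightarrow> nat \<Rightarrow> real \<Rightarrow> real" where
  "scaled_deriv \<epsilon> \<sigma> j x = \<sigma> ^ Suc j * band_density_deriv \<epsilon> j (\<sigma> * x)"

lemma scaled_deriv_0: "scaled_deriv \<epsilon> \<sigma> 0 = scaled_density \<epsilon> \<sigma>"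
  by (simp add: scaled_deriv_def scaled_density_def band_density_deriv_0 fun_eq_iff)

lemma scaled_deriv_Suc:
  "(scaled_deriv \<epsilon> \<sigma> j has_real_derivative scaled_deriv \<epsilon> \<sigma> (Suc j) x) (at x)"
proof -
  have "((\<lambda>x. band_density_deriv \<epsilon> j (\<sigma> * x)) has_real_derivative
      band_density_deriv \<epsilon> (Suc j) (\<sigma> * x) * \<sigma>) (at x)"
    by (rule DERIV_chain'[where g = "band_density_deriv \<epsilon> j", OF _ band_density_deriv_Suc, THEN DERIV_cong])
      (auto intro!: derivative_eq_intros)
  then have "((\<lambda>x. \<sigma> ^ Suc j * band_density_deriv \<epsilon> j (\<sigma> * x)) has_real_derivative
      \<sigma> ^ Suc j * (band_density_deriv \<epsilon> (Suc j) (\<sigma> * x) * \<sigma>)) (at x)"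
    by (rule DERIV_cmult)
  then show ?thesis by (simp add: scaled_deriv_def[abs_def] mult_ac)
qed

text \<open>The two competing coefficient densities, for \<open>\<epsilon> = 0\<close> and \<open>\<epsilon> = 1\<close>: wide (scale \<open>1 / \<sigma>\<close>) in the
intercept and narrow (scale \<open>1 / \<tau>\<close>) in the slope. Only the slope factor is modulated.\<close>

definition coeff_density :: "real \<Rightarrow> real \<Rightarrow> real \<Rightarrow> real \<times> real \<Rightarrow> real" where
  "coeff_density \<sigma> \<tau> \<epsilon> = tensor (scaled_density 0 \<sigma>) (scaled_density \<epsilon> \<tau>)"

lemma band_density_deriv_lipschitz:
  assumes "\<bar>\<epsilon>\<bar> \<le> 1"
  shows "\<bar>band_density_deriv \<epsilon> j x - band_density_deriv \<epsilon> j 0\<bar> \<le> 2 * 3 ^ Suc j / fejer_mass * \<bar>x\<bar>"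
  using field_differentiable_bound[of UNIV "band_density_deriv \<epsilon> j" "band_density_deriv \<epsilon> (Suc j)"
      "2 * 3 ^ Suc j / fejer_mass" x 0]
    abs_band_density_deriv_le[OF assms, of "Suc j"] band_density_deriv_Suc
  by auto

text \<open>A common bound for the derivatives of orders \<open>0, \<dots>, s + 1\<close> of all densities \<open>band_density \<epsilon>\<close> with
\<open>\<bar>\<epsilon>\<bar> \<le> 1\<close>; order \<open>s + 1\<close> is the Lipschitz constant of order \<open>s\<close>.\<close>

definition deriv_bound :: "nat \<Rightarrow> real" where
  "deriv_bound s = 2 * 3 ^ Suc s / fejer_mass"

lemma deriv_bound_nonneg: "0 \<le> deriv_bound s"
  using fejer_mass_pos by (simp add: deriv_bound_def)

lemma deriv_bound_mono: "j \<le> Suc s \<Longrightarrow> 2 * 3 ^ j / fejer_mass \<le> deriv_bound s"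
  unfolding deriv_bound_def using fejer_mass_pos
  by (intro divide_right_mono mult_left_mono power_increasing) auto

text \<open>A derivative of order \<open>s\<close> carries the factor \<open>\<sigma>\<^sup>k\<^sup>+\<^sup>1 \<tau>\<^sup>l\<^sup>+\<^sup>1 \<le> \<sigma> \<tau>\<^sup>s\<^sup>+\<^sup>1\<close>. Its variation over a distance \<open>r\<close> is
bounded as well as linear in \<open>\<tau> r\<close>, hence at most of order \<open>(\<tau> r)\<^sup>\<theta>\<close> with \<open>\<theta> = \<alpha> - s\<close>. The
total power of \<open>\<tau>\<close> is therefore \<open>1 + \<alpha>\<close>, which the choice of \<open>\<sigma>\<close> absorbs: the Hoelder constant does
not depend on the scales.\<close>

lemma scaled_deriv_hoelder:
  assumes \<epsilon>: "\<bar>\<epsilon>\<bar> \<le> 1" and \<sigma>: "0 < \<sigma>" "\<sigma> \<le> 1" and \<tau>: "1 \<le> \<tau>"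
    and \<alpha>: "\<alpha> > 0" and eq: "\<sigma> * \<tau> powr (1 + \<alpha>) \<le> 1"
    and kl: "k + l = strict_floor \<alpha>"
  shows "\<bar>scaled_deriv 0 \<sigma> k x * scaled_deriv \<epsilon> \<tau> l y - scaled_deriv 0 \<sigma> k 0 * scaled_deriv \<epsilon> \<tau> l 0\<bar>
     \<le> 2 * (deriv_bound (strict_floor \<alpha>))\<^sup>2 * norm (x, y) powr (\<alpha> - real (strict_floor \<alpha>))"
proof -
  define s where "s = strict_floor \<alpha>"
  define \<theta> where "\<theta> = \<alpha> - real s"
  define M where "M = deriv_bound s"
  define r where "r = norm (x, y)"
  have \<theta>: "0 < \<theta>" "\<theta> \<le> 1" using strict_floor_bounds[OF \<alpha>] by (auto simp: \<theta>_def s_def)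
  have M: "0 \<le> M" by (simp add: M_def deriv_bound_nonneg)
  have r: "0 \<le> r" "\<bar>x\<bar> \<le> r" "\<bar>y\<bar> \<le> r"
    using norm_fst_le[of x y] norm_snd_le[of y x] by (auto simp: r_def)
  define a where "a x = band_density_deriv 0 k (\<sigma> * x)" for x
  define b where "b y = band_density_deriv \<epsilon> l (\<tau> * y)" for y
  have aM: "\<bar>a x\<bar> \<le> M" for x
    unfolding a_def M_def by (rule order_trans[OF abs_band_density_deriv_le deriv_bound_mono]) (use kl s_def in auto)
  have bM: "\<bar>b x\<bar> \<le> M" for x
    unfolding b_def M_def by (rule order_trans[OF abs_band_density_deriv_le deriv_bound_mono]) (use kl s_def \<epsilon> in auto)
  have aL: "\<bar>a x - a 0\<bar> \<le> M * (\<tau> * r)"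
  proof -
    have "\<bar>a x - a 0\<bar> \<le> 2 * 3 ^ Suc k / fejer_mass * \<bar>\<sigma> * x\<bar>"
      using band_density_deriv_lipschitz[of 0 k "\<sigma> * x"] by (simp add: a_def)
    also have "\<dots> \<le> M * (\<tau> * r)"
      unfolding M_def abs_mult using kl s_def \<sigma> \<tau> r
      by (intro mult_mono deriv_bound_mono) (auto simp: deriv_bound_nonneg)
    finally show ?thesis .
  qed
  have bL: "\<bar>b y - b 0\<bar> \<le> M * (\<tau> * r)"
  proof -
    have "\<bar>b y - b 0\<bar> \<le> 2 * 3 ^ Suc l / fejer_mass * \<bar>\<tau> * y\<bar>"
      using band_density_deriv_lipschitz[OF \<epsilon>, of l "\<tau> * y"] by (simp add: b_def)
    also have "\<dots> \<le> M * (\<tau> * r)"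
      unfolding M_def abs_mult using kl s_def \<sigma> \<tau> r
      by (intro mult_mono deriv_bound_mono) (auto simp: deriv_bound_nonneg)
    finally show ?thesis .
  qed
  let ?d = "\<bar>a x * b y - a 0 * b 0\<bar>"
  have "?d \<le> \<bar>a x\<bar> * \<bar>b y\<bar> + \<bar>a 0\<bar> * \<bar>b 0\<bar>"
    using abs_triangle_ineq4[of "a x * b y" "a 0 * b 0"] by (simp add: abs_mult)
  also have "\<dots> \<le> M * M + M * M" using aM bM M by (intro add_mono mult_mono) auto
  finally have d1: "?d \<le> 2 * M\<^sup>2" by (simp add: power2_eq_square)
  have "a x * b y - a 0 * b 0 = a x * (b y - b 0) + (a x - a 0) * b 0" by (simp add: algebra_simps)
  then have "?d \<le> \<bar>a x\<bar> * \<bar>b y - b 0\<bar> + \<bar>a x - a 0\<bar> * \<bar>b 0\<bar>"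
    using abs_triangle_ineq[of "a x * (b y - b 0)" "(a x - a 0) * b 0"] by (simp add: abs_mult)
  also have "\<dots> \<le> M * (M * (\<tau> * r)) + (M * (\<tau> * r)) * M"
    using aM bM aL bL M r \<tau> by (intro add_mono mult_mono) auto
  finally have d2: "?d \<le> 2 * M\<^sup>2 * (\<tau> * r)" by (simp add: power2_eq_square algebra_simps)
  have d: "?d \<le> 2 * M\<^sup>2 * (\<tau> * r) powr \<theta>"
    using d1 d2 \<theta> r \<tau> by (intro le_powr_of_le_const_of_le_linear) auto
  have scale: "\<sigma> ^ Suc k * \<tau> ^ Suc l * \<tau> powr \<theta> \<le> 1"
  proof -
    have "\<sigma> ^ Suc k * \<tau> ^ Suc l * \<tau> powr \<theta> \<le> \<sigma> * \<tau> ^ Suc s * \<tau> powr \<theta>"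
      using \<sigma> \<tau> kl s_def power_decreasing[of 1 "Suc k" \<sigma>]
      by (intro mult_mono power_increasing) auto
    moreover have "\<tau> ^ Suc s * \<tau> powr \<theta> = \<tau> powr (1 + \<alpha>)"
      using \<tau> by (subst powr_realpow[symmetric]) (auto simp: powr_add[symmetric] \<theta>_def)
    ultimately show ?thesis using eq by (metis mult.assoc order_trans)
  qed
  have "\<bar>scaled_deriv 0 \<sigma> k x * scaled_deriv \<epsilon> \<tau> l y - scaled_deriv 0 \<sigma> k 0 * scaled_deriv \<epsilon> \<tau> l 0\<bar>
      = (\<sigma> ^ Suc k * \<tau> ^ Suc l) * ?d"
  proof -
    have "scaled_deriv 0 \<sigma> k x * scaled_deriv \<epsilon> \<tau> l y - scaled_deriv 0 \<sigma> k 0 * scaled_deriv \<epsilon> \<tau> l 0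
      = (\<sigma> ^ Suc k * \<tau> ^ Suc l) * (a x * b y - a 0 * b 0)"
      unfolding scaled_deriv_def a_def b_def by (simp add: algebra_simps)
    then show ?thesis using \<sigma> \<tau> by (simp add: abs_mult)
  qed
  also have "\<dots> \<le> (\<sigma> ^ Suc k * \<tau> ^ Suc l) * (2 * M\<^sup>2 * (\<tau> * r) powr \<theta>)"
    using d \<sigma> \<tau> by (intro mult_left_mono) auto
  also have "\<dots> = (\<sigma> ^ Suc k * \<tau> ^ Suc l * \<tau> powr \<theta>) * (2 * M\<^sup>2 * r powr \<theta>)"
    using r \<tau> by (simp add: powr_mult)
  also have "\<dots> \<le> 1 * (2 * M\<^sup>2 * r powr \<theta>)"
    using scale by (intro mult_right_mono) auto
  finally show ?thesis by (simp add: M_def s_def r_def \<theta>_def)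
qed

section \<open>Weak gradients of products of piecewise smooth functions\<close>

lemma integrable_continuous_compact_support_mult:
  fixes \<phi> b :: "real \<times> real \<Rightarrow> real"
  assumes \<phi>: "continuous_on UNIV \<phi>" and supp: "\<And>p. norm p > R \<Longrightarrow> \<phi> p = 0"
    and [measurable]: "b \<in> borel_measurable borel" and B: "\<And>p. \<bar>b p\<bar> \<le> B"
  shows "integrable lborel (\<lambda>p. \<phi> p * b p)"
proof (rule Bochner_Integration.integrable_bound)
  have "continuous_on (cball 0 R) (\<lambda>p. B * \<bar>\<phi> p\<bar>)"
    by (intro continuous_intros continuous_on_subset[OF \<phi>]) auto
  then show "integrable lborel (\<lambda>p. indicator (cball 0 R) p *\<^sub>R (B * \<bar>\<phi> p\<bar>))"
    using borel_integrable_compact[of "cball 0 R" "\<lambda>p. B * \<bar>\<phi> p\<bar>"]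
    by (simp add: set_integrable_def indicator_scaleR_eq_if if_distrib cong: if_cong)
  have [measurable]: "\<phi> \<in> borel_measurable borel"
    using \<phi> by (rule borel_measurable_continuous_onI)
  show "(\<lambda>p. \<phi> p * b p) \<in> borel_measurable lborel" by measurable
  have "B \<ge> 0" using B[of 0] by linarith
  have "norm (\<phi> p * b p) \<le> norm (indicator (cball 0 R) p *\<^sub>R (B * \<bar>\<phi> p\<bar>))" for p
  proof (cases "norm p \<le> R")
    case True
    have "\<bar>b p\<bar> * \<bar>\<phi> p\<bar> \<le> B * \<bar>\<phi> p\<bar>" using B by (rule mult_right_mono) simp
    with True \<open>B \<ge> 0\<close> show ?thesis by (simp add: abs_mult mult.commute)
  qed (use supp[of p] in simp)
  then show "AE p in lborel. norm (\<phi> p * b p) \<le> norm (indicator (cball 0 R) p *\<^sub>R (B * \<bar>\<phi> p\<bar>))"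
    by (rule AE_I2)
qed

lemma locally_integrable_bounded:
  fixes g :: "real \<times> real \<Rightarrow> 'b::{banach, second_countable_topology}"
  assumes [measurable]: "g \<in> borel_measurable borel" and B: "\<And>p. norm (g p) \<le> B"
  shows "locally_integrable g"
  unfolding locally_integrable_def
proof (intro allI impI)
  fix K :: "(real \<times> real) set" assume K: "compact K"
  then have [measurable]: "K \<in> sets borel" by (rule borel_compact)
  show "set_integrable lborel K g"
    unfolding set_integrable_def
  proof (rule Bochner_Integration.integrable_bound)
    show "integrable lborel (\<lambda>p. indicator K p *\<^sub>R B)"
      using emeasure_bounded_finite[OF compact_imp_bounded[OF K]] by (intro integrable_scaleR_left integrable_real_indicator) simp_all
    show "(\<lambda>p. indicator K p *\<^sub>R g p) \<in> borel_measurable lborel" by measurable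
    show "AE p in lborel. norm (indicator K p *\<^sub>R g p) \<le> norm (indicator K p *\<^sub>R B)"
      using B by (intro AE_I2) (auto simp: indicator_def intro: order_trans[OF _ abs_ge_self])
  qed
qed

lemma test_function_cont_deriv:
  assumes "test_function \<phi>"
  shows "continuous_on UNIV \<phi>" "continuous_on UNIV (pderiv1 \<phi>)" "continuous_on UNIV (pderiv2 \<phi>)"
    and "((\<lambda>t. \<phi> (t, y)) has_real_derivative pderiv1 \<phi> (x, y)) (at x)"
    and "((\<lambda>t. \<phi> (x, t)) has_real_derivative pderiv2 \<phi> (x, y)) (at y)"
proof -
  have "cont_differentiable_on k \<phi> UNIV" for k using assms by (simp add: test_function_def)
  from this[of 0] this[of "Suc 0"]
  show "continuous_on UNIV \<phi>" "continuous_on UNIV (pderiv1 \<phi>)" "continuous_on UNIV (pderiv2 \<phi>)"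
    and "((\<lambda>t. \<phi> (t, y)) has_real_derivative pderiv1 \<phi> (x, y)) (at x)"
    and "((\<lambda>t. \<phi> (x, t)) has_real_derivative pderiv2 \<phi> (x, y)) (at y)"
    by (auto simp: partially_differentiable_at_def pderiv1_def pderiv2_def
        DERIV_deriv_iff_field_differentiable)
qed

lemma test_function_support:
  assumes "test_function \<phi>"
  obtains R where "\<And>p. norm p > R \<Longrightarrow> \<phi> p = 0 \<and> pderiv1 \<phi> p = 0 \<and> pderiv2 \<phi> p = 0"
proof -
  have "bounded {p. \<phi> p \<noteq> 0}"
    using assms compact_imp_bounded bounded_subset closure_subset by (metis test_function_def)
  then obtain R where R: "\<And>p. \<phi> p \<noteq> 0 \<Longrightarrow> norm p \<le> R" by (auto simp: bounded_iff)
  have *: "pderiv1 \<phi> p = 0 \<and> pderiv2 \<phi> p = 0" if "norm p > R" for p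
  proof -
    obtain x y where p: "p = (x, y)" by (cases p)
    have "open {t. R < norm (t, y)}" "open {t. R < norm (x, t)}"
      by (auto intro!: open_Collect_less continuous_intros)
    then have "\<forall>\<^sub>F t in nhds x. R < norm (t, y)" "\<forall>\<^sub>F t in nhds y. R < norm (x, t)"
      using that p by (auto simp: eventually_nhds)
    then have "\<forall>\<^sub>F t in nhds x. \<phi> (t, y) = 0" "\<forall>\<^sub>F t in nhds y. \<phi> (x, t) = 0"
      using R by (auto elim!: eventually_mono simp: not_le[symmetric])
    from deriv_cong_ev[OF this(1) refl] deriv_cong_ev[OF this(2) refl]
    show ?thesis by (simp add: pderiv1_def pderiv2_def p)
  qed
  show ?thesis
    using R * by (intro that) (auto simp: not_le[symmetric])
qed

text \<open>A finite exceptional set accommodates the kinks of the tent function. On it the values of \<open>u'\<close> are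
arbitrary up to the bound; continuity of \<open>u\<close> keeps integration by parts valid across it.\<close>

definition bounded_piecewise_deriv :: "(real \<Rightarrow> real) \<Rightarrow> (real \<Rightarrow> real) \<Rightarrow> bool" where
  "bounded_piecewise_deriv u u' \<longleftrightarrow> continuous_on UNIV u \<and> u' \<in> borel_measurable borel \<and>
     (\<exists>B. \<forall>x. \<bar>u x\<bar> \<le> B \<and> \<bar>u' x\<bar> \<le> B) \<and>
     (\<exists>S. finite S \<and> (\<forall>x. x \<notin> S \<longrightarrow> (u has_real_derivative u' x) (at x)))"

text \<open>The integrand is the derivative, off a finite set, of the continuous function \<open>f u\<close>, which vanishes
at both ends of a large interval.\<close>

lemma integral_by_parts_zero:
  fixes f f' u u' :: "real \<Rightarrow> real"
  assumes f: "\<And>x. (f has_real_derivative f' x) (at x)" and f': "continuous_on UNIV f'"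
    and supp: "\<And>x. \<bar>x\<bar> > R \<Longrightarrow> f x = 0 \<and> f' x = 0"
    and u: "bounded_piecewise_deriv u u'"
  shows "(LINT x|lborel. f' x * u x + f x * u' x) = 0"
proof -
  obtain S B where cu: "continuous_on UNIV u" and [measurable]: "u' \<in> borel_measurable borel"
    and B: "\<And>x. \<bar>u x\<bar> \<le> B" "\<And>x. \<bar>u' x\<bar> \<le> B" and S: "finite S"
    and du: "\<And>x. x \<notin> S \<Longrightarrow> (u has_real_derivative u' x) (at x)"
    using u by (auto simp: bounded_piecewise_deriv_def)
  have cf: "continuous_on UNIV f" using f by (auto intro: DERIV_continuous_on)
  note [measurable] = borel_measurable_continuous_onI[OF cu] borel_measurable_continuous_onI[OF cf]
    borel_measurable_continuous_onI[OF f']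
  define r where "r = \<bar>R\<bar> + 1"
  have out: "f x = 0 \<and> f' x = 0" if "x \<notin> {-r..r}" for x
    using that supp[of x] by (auto simp: r_def)
  have f_end: "f r = 0" "f (- r) = 0" using supp[of r] supp[of "- r"] by (auto simp: r_def)
  let ?h = "\<lambda>x. f' x * u x + f x * u' x"
  have "(?h has_integral (f r * u r - f (- r) * u (- r))) {- r..r}"
  proof (rule fundamental_theorem_of_calculus_interior_strong[OF S])
    show "((\<lambda>x. f x * u x) has_vector_derivative ?h x) (at x)" if "x \<in> {- r<..<r} - S" for x
      using that f du unfolding has_real_derivative_iff_has_vector_derivative[symmetric]
      by (auto intro!: derivative_eq_intros)
    show "continuous_on {- r..r} (\<lambda>x. f x * u x)"
      by (intro continuous_on_mult continuous_on_subset[OF cf] continuous_on_subset[OF cu]) auto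
  qed (simp add: r_def)
  then have "(?h has_integral 0) {- r..r}" by (simp add: f_end)
  then have zero: "(?h has_integral 0) UNIV"
    by (rule has_integral_on_superset[OF _ _ subset_UNIV]) (simp add: out)
  have "integrable lborel ?h"
  proof (rule Bochner_Integration.integrable_bound)
    have "continuous_on {- r..r} (\<lambda>x. (\<bar>f' x\<bar> + \<bar>f x\<bar>) * B)"
      by (intro continuous_intros continuous_on_subset[OF cf] continuous_on_subset[OF f']) auto
    then show "integrable lborel (\<lambda>x. indicator {- r..r} x *\<^sub>R ((\<bar>f' x\<bar> + \<bar>f x\<bar>) * B))"
      by (rule borel_integrable_atLeastAtMost'[unfolded set_integrable_def])
    show "?h \<in> borel_measurable lborel" by measurable
    show "AE x in lborel. norm (?h x) \<le> norm (indicator {- r..r} x *\<^sub>R ((\<bar>f' x\<bar> + \<bar>f x\<bar>) * B))"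
    proof (intro AE_I2)
      fix x
      show "norm (?h x) \<le> norm (indicator {- r..r} x *\<^sub>R ((\<bar>f' x\<bar> + \<bar>f x\<bar>) * B))"
      proof (cases "x \<in> {- r..r}")
        case True
        have "\<bar>?h x\<bar> \<le> \<bar>f' x\<bar> * \<bar>u x\<bar> + \<bar>f x\<bar> * \<bar>u' x\<bar>"
          by (rule order_trans[OF abs_triangle_ineq]) (simp add: abs_mult)
        also have "\<dots> \<le> \<bar>f' x\<bar> * B + \<bar>f x\<bar> * B" using B by (intro add_mono mult_left_mono) auto
        also have "\<dots> \<le> \<bar>(\<bar>f' x\<bar> + \<bar>f x\<bar>) * B\<bar>" by (simp add: distrib_right)
        finally show ?thesis using True by simp
      qed (use out in simp)
    qed
  qed
  then have "(?h has_integral (LINT x|lborel. ?h x)) UNIV" by (rule has_integral_integral_lborel)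
  with zero show ?thesis by (rule has_integral_unique[rotated])
qed

text \<open>By Fubini, each of the two defining identities reduces to one-dimensional integration by parts in
the differentiated variable, with the other factor constant.\<close>

lemma weak_gradient_tensor:
  assumes u: "bounded_piecewise_deriv u u'" and w: "bounded_piecewise_deriv w w'"
  shows "weak_gradient (\<lambda>p. complex_of_real (tensor u w p))
     (\<lambda>p. (complex_of_real (tensor u' w p), complex_of_real (tensor u w' p)))"
proof -
  obtain B where B: "\<And>x. \<bar>u x\<bar> \<le> B" "\<And>x. \<bar>u' x\<bar> \<le> B" using u by (auto simp: bounded_piecewise_deriv_def)
  obtain C where C: "\<And>x. \<bar>w x\<bar> \<le> C" "\<And>x. \<bar>w' x\<bar> \<le> C" using w by (auto simp: bounded_piecewise_deriv_def)
  have BC: "0 \<le> B" "0 \<le> C" using B(1)[of 0] C(1)[of 0] by auto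
  have [measurable]: "u \<in> borel_measurable borel" "w \<in> borel_measurable borel"
    "u' \<in> borel_measurable borel" "w' \<in> borel_measurable borel"
    using u w by (auto simp: bounded_piecewise_deriv_def intro: borel_measurable_continuous_onI)
  have meas: "tensor u w \<in> borel_measurable borel" "tensor u' w \<in> borel_measurable borel"
    "tensor u w' \<in> borel_measurable borel"
    unfolding tensor_def borel_prod[symmetric] by measurable
  note [measurable] = meas
  have bd: "\<bar>tensor u w p\<bar> \<le> B * C" "\<bar>tensor u' w p\<bar> \<le> B * C" "\<bar>tensor u w' p\<bar> \<le> B * C" for p
    using B C BC by (auto simp: tensor_def abs_mult split: prod.split intro!: mult_mono)
  have "locally_integrable (\<lambda>p. complex_of_real (tensor u w p))"
    using bd by (intro locally_integrable_bounded[where B = "B * C"]) auto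
  moreover have "locally_integrable
      (\<lambda>p. (complex_of_real (tensor u' w p), complex_of_real (tensor u w' p)))"
  proof (rule locally_integrable_bounded[where B = "B * C + B * C"])
    show "norm (complex_of_real (tensor u' w p), complex_of_real (tensor u w' p)) \<le> B * C + B * C" for p
      by (rule order_trans[OF norm_Pair_le]) (use add_mono[OF bd(2)[of p] bd(3)[of p]] in simp)
  qed measurable
  moreover have "(LINT p|lborel. pderiv1 \<phi> p *\<^sub>R complex_of_real (tensor u w p))
        = - (LINT p|lborel. \<phi> p *\<^sub>R complex_of_real (tensor u' w p))"
     "(LINT p|lborel. pderiv2 \<phi> p *\<^sub>R complex_of_real (tensor u w p))
        = - (LINT p|lborel. \<phi> p *\<^sub>R complex_of_real (tensor u w' p))" if \<phi>: "test_function \<phi>" for \<phi>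
  proof -
    obtain R where R: "\<And>p. norm p > R \<Longrightarrow> \<phi> p = 0 \<and> pderiv1 \<phi> p = 0 \<and> pderiv2 \<phi> p = 0"
      using test_function_support[OF \<phi>] by blast
    note d = test_function_cont_deriv[OF \<phi>]
    have sec: "continuous_on UNIV (\<lambda>x. f (x, y))" "continuous_on UNIV (\<lambda>x. f (y, x))"
      if "continuous_on UNIV f" for f :: "real \<times> real \<Rightarrow> real" and y
      using that by (auto intro!: continuous_on_compose2[OF that] continuous_intros)
    have I: "integrable lborel (\<lambda>p. pderiv1 \<phi> p * tensor u w p)"
        "integrable lborel (\<lambda>p. pderiv2 \<phi> p * tensor u w p)"
        "integrable lborel (\<lambda>p. \<phi> p * tensor u' w p)" "integrable lborel (\<lambda>p. \<phi> p * tensor u w' p)"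
      using R by (auto intro!: integrable_continuous_compact_support_mult[where R = R and B = "B * C"] d meas bd)
    have out: "R < norm (x, y) \<and> R < norm (y, x)" if "R < \<bar>x\<bar>" for x y :: real
      using that norm_fst_le[of x y] norm_snd_le[of x y] by auto
    have x0: "(LINT x|lborel. pderiv1 \<phi> (x, y) * u x + \<phi> (x, y) * u' x) = 0" for y
      using R out by (intro integral_by_parts_zero[where R = R and f = "\<lambda>x. \<phi> (x, y)"
          and f' = "\<lambda>x. pderiv1 \<phi> (x, y)"] d sec u) auto
    have y0: "(LINT y|lborel. pderiv2 \<phi> (x, y) * w y + \<phi> (x, y) * w' y) = 0" for x
      using R out by (intro integral_by_parts_zero[where R = R and f = "\<lambda>y. \<phi> (x, y)"
          and f' = "\<lambda>y. pderiv2 \<phi> (x, y)"] d sec w) auto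
    have "(LINT p|lborel. pderiv1 \<phi> p * tensor u w p) + (LINT p|lborel. \<phi> p * tensor u' w p)
        = (LINT p|(lborel \<Otimes>\<^sub>M lborel). (\<lambda>(x, y). (pderiv1 \<phi> (x, y) * u x + \<phi> (x, y) * u' x) * w y) p)"
      unfolding lborel_prod Bochner_Integration.integral_add[OF I(1) I(3), symmetric]
      by (rule Bochner_Integration.integral_cong) (auto simp: tensor_def algebra_simps)
    also have "\<dots> = (LINT y|lborel. LINT x|lborel. (pderiv1 \<phi> (x, y) * u x + \<phi> (x, y) * u' x) * w y)"
    proof (rule lborel_pair.integral_snd[symmetric])
      show "integrable (lborel \<Otimes>\<^sub>M lborel) (\<lambda>(x, y). (pderiv1 \<phi> (x, y) * u x + \<phi> (x, y) * u' x) * w y)"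
        unfolding lborel_prod using Bochner_Integration.integrable_add[OF I(1) I(3)]
        by (rule Bochner_Integration.integrable_cong[THEN iffD1, rotated 2])
          (auto simp: tensor_def algebra_simps)
    qed
    also have "\<dots> = 0" by (simp add: x0)
    finally have X: "(LINT p|lborel. pderiv1 \<phi> p * tensor u w p) = - (LINT p|lborel. \<phi> p * tensor u' w p)"
      by simp
    have "(LINT p|lborel. pderiv2 \<phi> p * tensor u w p) + (LINT p|lborel. \<phi> p * tensor u w' p)
        = (LINT p|(lborel \<Otimes>\<^sub>M lborel). (\<lambda>(x, y). (pderiv2 \<phi> (x, y) * w y + \<phi> (x, y) * w' y) * u x) p)"
      unfolding lborel_prod Bochner_Integration.integral_add[OF I(2) I(4), symmetric]
      by (rule Bochner_Integration.integral_cong) (auto simp: tensor_def algebra_simps)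
    also have "\<dots> = (LINT x|lborel. LINT y|lborel. (pderiv2 \<phi> (x, y) * w y + \<phi> (x, y) * w' y) * u x)"
    proof (rule lborel_pair.integral_fst[symmetric])
      show "integrable (lborel \<Otimes>\<^sub>M lborel) (\<lambda>(x, y). (pderiv2 \<phi> (x, y) * w y + \<phi> (x, y) * w' y) * u x)"
        unfolding lborel_prod using Bochner_Integration.integrable_add[OF I(2) I(4)]
        by (rule Bochner_Integration.integrable_cong[THEN iffD1, rotated 2])
          (auto simp: tensor_def algebra_simps)
    qed
    also have "\<dots> = 0" by (simp add: y0)
    finally have Y: "(LINT p|lborel. pderiv2 \<phi> p * tensor u w p) = - (LINT p|lborel. \<phi> p * tensor u w' p)"
      by simp
    have eq: "f p *\<^sub>R complex_of_real (g p) = complex_of_real (f p * g p)" for f g and p :: "real \<times> real"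
      by (simp add: scaleR_conv_of_real)
    from X Y show "(LINT p|lborel. pderiv1 \<phi> p *\<^sub>R complex_of_real (tensor u w p))
        = - (LINT p|lborel. \<phi> p *\<^sub>R complex_of_real (tensor u' w p))"
     "(LINT p|lborel. pderiv2 \<phi> p *\<^sub>R complex_of_real (tensor u w p))
        = - (LINT p|lborel. \<phi> p *\<^sub>R complex_of_real (tensor u w' p))"
      unfolding eq integral_complex_of_real by simp_all
  qed
  ultimately show ?thesis by (simp add: weak_gradient_def)
qed

section \<open>The competing densities belong to the class\<close>

definition tent_deriv :: "real \<Rightarrow> real" where
  "tent_deriv t = (sgn (1 + t) - sgn (1 - t)) / 2 - sgn t"

definition band_char_deriv :: "real \<Rightarrow> real \<Rightarrow> real" where
  "band_char_deriv \<epsilon> t = tent_deriv t + \<epsilon> / 2 * (tent_deriv (t + 2) + tent_deriv (t - 2))"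

lemma abs_tent_deriv_le: "\<bar>tent_deriv t\<bar> \<le> 1"
  by (auto simp: tent_deriv_def sgn_real_def)

lemma tent_deriv_eq_0: "\<bar>t\<bar> > 1 \<Longrightarrow> tent_deriv t = 0"
  by (auto simp: tent_deriv_def sgn_real_def abs_if split: if_splits)

lemma has_real_derivative_abs:
  fixes x :: real assumes "x \<noteq> 0" shows "(abs has_real_derivative sgn x) (at x)"
proof (cases "x > 0")
  case True
  have "(abs has_real_derivative 1) (at x)"
    by (rule has_field_derivative_transform_within_open[where S = "{0<..}" and f = "\<lambda>x. x"])
      (use True in auto)
  with True show ?thesis by simp
next
  case False
  have "(abs has_real_derivative - 1) (at x)"
    by (rule has_field_derivative_transform_within_open[where S = "{..<0}" and f = "\<lambda>x. - x"])
      (use False assms in \<open>auto intro!: derivative_eq_intros\<close>)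
  with False assms show ?thesis by simp
qed

lemma tent_has_deriv:
  assumes "t \<notin> {-1, 0, 1}" shows "(tent has_real_derivative tent_deriv t) (at t)"
proof -
  have *: "((\<lambda>t. \<bar>g t\<bar>) has_real_derivative sgn (g t) * g') (at t)"
    if "(g has_real_derivative g') (at t)" "g t \<noteq> 0" for g g'
    using DERIV_chain'[OF that(1), of abs "sgn (g t)"] that(2)
    by (simp add: has_real_derivative_abs mult.commute)
  have "((\<lambda>t. (\<bar>1 + t\<bar> + \<bar>1 - t\<bar>) / 2 - \<bar>t\<bar>) has_real_derivative
      (sgn (1 + t) * 1 + sgn (1 - t) * (- 1)) / 2 - sgn t * 1) (at t)"
    using assms by (intro DERIV_diff DERIV_cdivide DERIV_add *) (auto intro!: derivative_eq_intros)
  then show ?thesis by (simp add: tent_def[abs_def] tent_deriv_def)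
qed

lemma abs_band_char_le:
  assumes "\<bar>\<epsilon>\<bar> \<le> 1" shows "\<bar>band_char \<epsilon> t\<bar> \<le> 2" "\<bar>band_char_deriv \<epsilon> t\<bar> \<le> 2"
proof -
  have *: "\<bar>a + \<epsilon> / 2 * (b + c)\<bar> \<le> 2" if "\<bar>a\<bar> \<le> 1" "\<bar>b\<bar> \<le> 1" "\<bar>c\<bar> \<le> 1" for a b c
  proof -
    have "\<bar>\<epsilon> / 2 * (b + c)\<bar> \<le> 1 / 2 * 2" unfolding abs_mult using assms that by (intro mult_mono) auto
    with that show ?thesis by linarith
  qed
  show "\<bar>band_char \<epsilon> t\<bar> \<le> 2" unfolding band_char_def using tent_bounds by (intro *) auto
  show "\<bar>band_char_deriv \<epsilon> t\<bar> \<le> 2" unfolding band_char_deriv_def by (intro * abs_tent_deriv_le)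
qed

lemma bounded_piecewise_deriv_band_char:
  assumes "\<bar>\<epsilon>\<bar> \<le> 1" and \<sigma>: "\<sigma> > 0"
  shows "bounded_piecewise_deriv (\<lambda>x. band_char \<epsilon> (x / \<sigma>)) (\<lambda>x. band_char_deriv \<epsilon> (x / \<sigma>) / \<sigma>)"
  unfolding bounded_piecewise_deriv_def
proof (intro conjI exI allI impI)
  show "continuous_on UNIV (\<lambda>x. band_char \<epsilon> (x / \<sigma>))"
    unfolding band_char_def tent_def using \<sigma> by (intro continuous_intros) auto
  show "(\<lambda>x. band_char_deriv \<epsilon> (x / \<sigma>) / \<sigma>) \<in> borel_measurable borel"
    unfolding band_char_deriv_def tent_deriv_def by measurable
  show "\<bar>band_char \<epsilon> (x / \<sigma>)\<bar> \<le> 2 + 2 / \<sigma>" for x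
    using abs_band_char_le[OF assms(1), of "x / \<sigma>"] \<sigma> by (simp add: add_increasing2)
  show "\<bar>band_char_deriv \<epsilon> (x / \<sigma>) / \<sigma>\<bar> \<le> 2 + 2 / \<sigma>" for x
    using abs_band_char_le[OF assms(1), of "x / \<sigma>"] \<sigma>
    by (simp add: add_increasing divide_right_mono)
  \<comment> \<open>The kinks of the tents centred at \<open>- 2\<close>, \<open>0\<close> and \<open>2\<close>.\<close>
  let ?T = "{-3, -2, -1, 0, 1, 2, 3} :: real set"
  show "finite ((\<lambda>t. \<sigma> * t) ` ?T)" by simp
  fix x assume x: "x \<notin> (\<lambda>t. \<sigma> * t) ` ?T"
  have T: "x / \<sigma> \<notin> ?T"
  proof
    assume "x / \<sigma> \<in> ?T"
    then have "\<sigma> * (x / \<sigma>) \<in> (\<lambda>t. \<sigma> * t) ` ?T" by (rule imageI)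
    with x \<sigma> show False by simp
  qed
  have d: "((\<lambda>x. tent (x / \<sigma> + c)) has_real_derivative tent_deriv (x / \<sigma> + c) * (1 / \<sigma>)) (at x)"
    if "x / \<sigma> + c \<notin> {-1, 0, 1}" for c
    by (rule DERIV_chain'[where f = "\<lambda>x. x / \<sigma> + c", OF _ tent_has_deriv[OF that]])
      (use \<sigma> in \<open>auto intro!: derivative_eq_intros\<close>)
  have "((\<lambda>x. tent (x / \<sigma> + 0) + \<epsilon> / 2 * (tent (x / \<sigma> + 2) + tent (x / \<sigma> + - 2))) has_real_derivative
     tent_deriv (x / \<sigma> + 0) * (1 / \<sigma>)
       + \<epsilon> / 2 * (tent_deriv (x / \<sigma> + 2) * (1 / \<sigma>) + tent_deriv (x / \<sigma> + - 2) * (1 / \<sigma>))) (at x)"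
    using T by (intro DERIV_add DERIV_cmult d) (auto simp: field_simps \<sigma>)
  then show "((\<lambda>x. band_char \<epsilon> (x / \<sigma>)) has_real_derivative band_char_deriv \<epsilon> (x / \<sigma>) / \<sigma>) (at x)"
    by (simp add: band_char_def[abs_def] band_char_deriv_def add_divide_distrib algebra_simps)
qed

lemma prob_density_integrable:
  assumes "prob_density f" shows "integrable lborel f"
proof -
  have [measurable]: "f \<in> borel_measurable borel" and "\<And>x. 0 \<le> f x"
    and "(\<integral>\<^sup>+x. ennreal (f x) \<partial>lborel) = ennreal 1"
    using assms by (auto simp: prob_density_def)
  then have "has_bochner_integral lborel f 1"
    by (intro has_bochner_integral_nn_integral) auto
  then show ?thesis by (simp add: has_bochner_integral_iff)
qed

lemma prob_space_law_of_density: "prob_density f \<Longrightarrow> prob_space (law_of_density f)"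
  by (auto simp: law_of_density_def prob_density_def emeasure_density intro!: prob_spaceI)

lemma sets_law_of_density [simp, measurable_cong]: "sets (law_of_density f) = sets borel"
  by (simp add: law_of_density_def)

lemma space_law_of_density [simp]: "space (law_of_density f) = UNIV"
  by (simp add: law_of_density_def)

lemma measurable_tensor:
  assumes [measurable]: "g \<in> borel_measurable borel" "h \<in> borel_measurable borel"
  shows "tensor g h \<in> borel_measurable borel"
  unfolding tensor_def borel_prod[symmetric] by measurable

lemma prob_density_tensor:
  assumes g: "prob_density g" and h: "prob_density h"
  shows "prob_density (tensor g h)"
proof -
  have [measurable]: "g \<in> borel_measurable borel" "h \<in> borel_measurable borel"
    and nn: "\<And>x. 0 \<le> g x" "\<And>x. 0 \<le> h x"
    and one: "(\<integral>\<^sup>+x. ennreal (g x) \<partial>lborel) = 1" "(\<integral>\<^sup>+x. ennreal (h x) \<partial>lborel) = 1"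
    using g h by (auto simp: prob_density_def)
  have "(\<integral>\<^sup>+p. ennreal (tensor g h p) \<partial>lborel)
      = (\<integral>\<^sup>+p. ennreal (g (fst p)) * ennreal (h (snd p)) \<partial>(lborel \<Otimes>\<^sub>M lborel))"
    unfolding lborel_prod
    by (rule nn_integral_cong) (auto simp: tensor_def ennreal_mult nn)
  also have "\<dots> = (\<integral>\<^sup>+x. \<integral>\<^sup>+y. ennreal (g x) * ennreal (h y) \<partial>lborel \<partial>lborel)"
    by (subst lborel.nn_integral_fst[symmetric]) auto
  also have "\<dots> = 1" by (simp add: nn_integral_cmult one)
  finally show ?thesis
    by (auto simp: prob_density_def tensor_def nn intro!: measurable_tensor[unfolded tensor_def])
qed

lemma char_fun_tensor:
  assumes g: "prob_density g" and h: "prob_density h"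
  shows "char_fun (tensor g h) (s, t) =
    (LINT x|lborel. complex_of_real (g x) * iexp (s * x)) * (LINT y|lborel. complex_of_real (h y) * iexp (t * y))"
proof -
  have [measurable]: "g \<in> borel_measurable borel" "h \<in> borel_measurable borel"
    using g h by (auto simp: prob_density_def)
  note P = prob_density_tensor[OF g h]
  then have [measurable]: "tensor g h \<in> borel_measurable borel" and nn: "\<And>p. 0 \<le> tensor g h p"
    by (auto simp: prob_density_def)
  have [measurable]: "(\<lambda>p. (s, t) \<bullet> p) \<in> borel_measurable borel"
    by (intro borel_measurable_continuous_onI continuous_intros)
  have eq: "tensor g h p *\<^sub>R exp (\<i> * complex_of_real ((s, t) \<bullet> p))
      = (\<lambda>(x, y). (complex_of_real (g x) * iexp (s * x)) * (complex_of_real (h y) * iexp (t * y))) p" for p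
    by (cases p) (simp add: tensor_def scaleR_conv_of_real exp_add distrib_left)
  have "integrable lborel (\<lambda>p. tensor g h p *\<^sub>R exp (\<i> * complex_of_real ((s, t) \<bullet> p)))"
    by (rule Bochner_Integration.integrable_bound[OF prob_density_integrable[OF P]]) (auto simp: nn)
  then have I: "integrable (lborel \<Otimes>\<^sub>M lborel)
      (\<lambda>(x, y). (complex_of_real (g x) * iexp (s * x)) * (complex_of_real (h y) * iexp (t * y)))"
    unfolding lborel_prod eq .
  have "char_fun (tensor g h) (s, t)
      = (LINT p|lborel. tensor g h p *\<^sub>R exp (\<i> * complex_of_real ((s, t) \<bullet> p)))"
    unfolding char_fun_def law_of_density_def by (rule integral_density) (auto simp: nn)
  also have "\<dots> = (LINT p|(lborel \<Otimes>\<^sub>M lborel).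
      (\<lambda>(x, y). (complex_of_real (g x) * iexp (s * x)) * (complex_of_real (h y) * iexp (t * y))) p)"
    unfolding lborel_prod eq ..
  also have "\<dots> = (LINT x|lborel. LINT y|lborel.
      (complex_of_real (g x) * iexp (s * x)) * (complex_of_real (h y) * iexp (t * y)))"
    using lborel_pair.integral_fst[OF I] by simp
  finally show ?thesis by simp
qed

lemma prob_density_scaled_density:
  assumes "\<bar>\<epsilon>\<bar> \<le> 1" "\<sigma> > 0" shows "prob_density (scaled_density \<epsilon> \<sigma>)"
proof -
  have "(\<integral>\<^sup>+x. ennreal (scaled_density \<epsilon> \<sigma> x) \<partial>lborel)
      = ennreal \<bar>\<sigma>\<bar> * (\<integral>\<^sup>+x. ennreal (band_density \<epsilon> (0 + \<sigma> * x)) \<partial>lborel)"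
    using assms by (subst nn_integral_cmult[symmetric])
      (auto simp: scaled_density_def ennreal_mult band_density_nonneg)
  also have "\<dots> = (\<integral>\<^sup>+x. ennreal (band_density \<epsilon> x) \<partial>lborel)"
    using assms by (intro nn_integral_real_affine[symmetric]) auto
  also have "\<dots> = 1" using prob_density_band_density[OF assms(1)] by (simp add: prob_density_def)
  finally show ?thesis
    using assms by (auto simp: prob_density_def scaled_density_def band_density_nonneg)
qed

lemma integral_scaled_density_iexp:
  assumes \<sigma>: "\<sigma> > 0"
  shows "(LINT x|lborel. complex_of_real (scaled_density \<epsilon> \<sigma> x) * iexp (t * x))
    = complex_of_real (band_char \<epsilon> (t / \<sigma>))"
proof -
  let ?f = "\<lambda>x. complex_of_real (band_density \<epsilon> x) * iexp (t / \<sigma> * x)"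
  have "(LINT x|lborel. complex_of_real (scaled_density \<epsilon> \<sigma> x) * iexp (t * x))
      = (LINT x|lborel. complex_of_real \<sigma> * ?f (0 + \<sigma> * x))"
    using \<sigma> by (intro Bochner_Integration.integral_cong) (auto simp: scaled_density_def)
  also have "\<dots> = \<bar>\<sigma>\<bar> *\<^sub>R (LINT x|lborel. ?f (0 + \<sigma> * x))"
    using \<sigma> by (simp add: scaleR_conv_of_real)
  also have "\<dots> = (LINT x|lborel. ?f x)"
    using \<sigma> by (intro lborel_integral_real_affine[symmetric]) auto
  also have "\<dots> = complex_of_real (band_char \<epsilon> (t / \<sigma>))"
    using has_integral_band_density_iexp by (simp only: has_bochner_integral_iff)
  finally show ?thesis .
qed

lemma prob_density_coeff_density:
  assumes "\<bar>\<epsilon>\<bar> \<le> 1" "\<sigma> > 0" "\<tau> > 0" shows "prob_density (coeff_density \<sigma> \<tau> \<epsilon>)"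
  unfolding coeff_density_def using assms by (intro prob_density_tensor prob_density_scaled_density) auto

lemma char_fun_coeff_density:
  assumes "\<bar>\<epsilon>\<bar> \<le> 1" "\<sigma> > 0" "\<tau> > 0"
  shows "char_fun (coeff_density \<sigma> \<tau> \<epsilon>)
    = (\<lambda>p. complex_of_real (tensor (\<lambda>x. band_char 0 (x / \<sigma>)) (\<lambda>y. band_char \<epsilon> (y / \<tau>)) p))"
proof
  fix p show "char_fun (coeff_density \<sigma> \<tau> \<epsilon>) p
    = complex_of_real (tensor (\<lambda>x. band_char 0 (x / \<sigma>)) (\<lambda>y. band_char \<epsilon> (y / \<tau>)) p)"
    using assms
    using char_fun_tensor[OF prob_density_scaled_density[of 0 \<sigma>] prob_density_scaled_density[of \<epsilon> \<tau>],
        of "fst p" "snd p"]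
      integral_scaled_density_iexp[of \<sigma> 0 "fst p"] integral_scaled_density_iexp[of \<tau> \<epsilon> "snd p"]
    by (simp add: coeff_density_def) (simp add: tensor_def split_beta)
qed

text \<open>The characteristic function is \<open>tent (x / \<sigma>)\<close> times a function of \<open>y / \<tau>\<close> bounded by \<open>2\<close>. Its
gradient vanishes for \<open>\<bar>x\<bar> > \<sigma>\<close> and is at most \<open>2 / \<sigma> + 2 / \<tau>\<close> elsewhere; integrating over an
interval of length \<open>2 \<sigma>\<close> cancels the large factor \<open>1 / \<sigma>\<close>, which is why \<open>\<sigma>\<close> may tend to \<open>0\<close>.\<close>

lemma char_fun_gradient_bound:
  assumes \<epsilon>: "\<bar>\<epsilon>\<bar> \<le> 1" and \<sigma>: "0 < \<sigma>" "\<sigma> \<le> 1" and \<tau>: "1 \<le> \<tau>"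
  shows "\<exists>g. weak_gradient (char_fun (coeff_density \<sigma> \<tau> \<epsilon>)) g \<and>
     (\<integral>\<^sup>+x. esssup lborel (\<lambda>y. ennreal (norm (g (x, y)))) \<partial>lborel) \<le> ennreal 8"
proof -
  define u where "u x = band_char 0 (x / \<sigma>)" for x
  define u' where "u' x = band_char_deriv 0 (x / \<sigma>) / \<sigma>" for x
  define w where "w y = band_char \<epsilon> (y / \<tau>)" for y
  define w' where "w' y = band_char_deriv \<epsilon> (y / \<tau>) / \<tau>" for y
  define g where "g p = (complex_of_real (tensor u' w p), complex_of_real (tensor u w' p))" for p
  have pu: "bounded_piecewise_deriv u u'" and pw: "bounded_piecewise_deriv w w'"
    unfolding u_def[abs_def] u'_def[abs_def] w_def[abs_def] w'_def[abs_def]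
    using \<epsilon> \<sigma> \<tau> by (auto intro!: bounded_piecewise_deriv_band_char)
  then have [measurable]: "w \<in> borel_measurable borel" "w' \<in> borel_measurable borel"
    by (auto simp: bounded_piecewise_deriv_def intro: borel_measurable_continuous_onI)
  have "weak_gradient (char_fun (coeff_density \<sigma> \<tau> \<epsilon>)) g"
    unfolding g_def[abs_def] using weak_gradient_tensor[OF pu pw] \<epsilon> \<sigma> \<tau>
    by (simp add: char_fun_coeff_density u_def[abs_def] w_def[abs_def])
  moreover have "(\<integral>\<^sup>+x. esssup lborel (\<lambda>y. ennreal (norm (g (x, y)))) \<partial>lborel) \<le> ennreal 8"
  proof -
    let ?c = "2 / \<sigma> + 2 / \<tau>"
    have c: "0 \<le> ?c" using \<sigma> \<tau> by simp
    have bound: "norm (g (x, y)) \<le> indicator {-\<sigma>..\<sigma>} x * ?c" for x y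
    proof (cases "\<bar>x\<bar> \<le> \<sigma>")
      case True
      have "\<bar>u' x * w y\<bar> \<le> (1 / \<sigma>) * 2"
        unfolding abs_mult u'_def w_def using abs_band_char_le[OF \<epsilon>] abs_tent_deriv_le \<sigma>
        by (intro mult_mono) (auto simp: band_char_deriv_def divide_right_mono)
      moreover have "\<bar>u x * w' y\<bar> \<le> 1 * (2 / \<tau>)"
        unfolding abs_mult u_def w'_def using abs_band_char_le[OF \<epsilon>] tent_bounds \<tau>
        by (intro mult_mono) (auto simp: band_char_def divide_right_mono)
      ultimately have "norm (g (x, y)) \<le> ?c"
        by (intro order_trans[OF norm_Pair_le[of "fst (g (x, y))" "snd (g (x, y))", simplified]])
          (auto simp: g_def tensor_def norm_mult abs_mult)
      with True show ?thesis by (simp add: abs_le_iff)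
    next
      case False
      then have "1 < \<bar>x / \<sigma>\<bar>" using \<sigma> by (simp add: abs_divide)
      then have "u x = 0" "u' x = 0"
        by (auto simp: u_def u'_def band_char_def band_char_deriv_def tent_eq_0 tent_deriv_eq_0)
      then show ?thesis using c by (simp add: g_def tensor_def zero_prod_def[symmetric])
    qed
    have "esssup lborel (\<lambda>y. ennreal (norm (g (x, y)))) \<le> ennreal ?c * indicator {-\<sigma>..\<sigma>} x" for x
    proof (rule esssup_I)
      show "(\<lambda>y. ennreal (norm (g (x, y)))) \<in> borel_measurable lborel"
        by (simp add: g_def tensor_def)
      show "AE y in lborel. ennreal (norm (g (x, y))) \<le> ennreal ?c * indicator {-\<sigma>..\<sigma>} x"
        using bound[of x] c by (intro AE_I2) (auto simp: indicator_def intro!: ennreal_leI split: if_splits)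
    qed
    then have "(\<integral>\<^sup>+x. esssup lborel (\<lambda>y. ennreal (norm (g (x, y)))) \<partial>lborel)
        \<le> (\<integral>\<^sup>+x. ennreal ?c * indicator {-\<sigma>..\<sigma>} x \<partial>lborel)"
      by (rule nn_integral_mono)
    also have "\<dots> = ennreal (?c * (2 * \<sigma>))"
      using \<sigma> c by (simp add: nn_integral_cmult_indicator ennreal_mult[symmetric])
    also have "\<dots> \<le> ennreal 8"
    proof (rule ennreal_leI)
      have "?c * (2 * \<sigma>) = 4 + 4 * (\<sigma> / \<tau>)" using \<sigma> \<tau> by (simp add: field_simps)
      moreover have "\<sigma> / \<tau> \<le> 1" using \<sigma> \<tau> by simp
      ultimately show "?c * (2 * \<sigma>) \<le> 8" by linarith
    qed
    finally show ?thesis .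
  qed
  ultimately show ?thesis by blast
qed

lemma coeff_density_le:
  assumes "\<bar>\<epsilon>\<bar> \<le> 1" "\<sigma> > 0" "\<tau> > 0"
  shows "coeff_density \<sigma> \<tau> \<epsilon> p \<le> \<sigma> * \<tau> * (2 / fejer_mass)\<^sup>2"
proof -
  have "band_density \<epsilon> x \<le> 2 / fejer_mass" if "\<bar>\<epsilon>\<bar> \<le> 1" for \<epsilon> x
    using abs_band_density_deriv_le[OF that, of 0 x] by (simp add: band_density_deriv_0)
  then have "(\<sigma> * band_density 0 (\<sigma> * fst p)) * (\<tau> * band_density \<epsilon> (\<tau> * snd p))
      \<le> (\<sigma> * (2 / fejer_mass)) * (\<tau> * (2 / fejer_mass))"
    using assms fejer_mass_pos by (intro mult_mono mult_nonneg_nonneg band_density_nonneg) auto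
  then show ?thesis
    by (simp add: coeff_density_def tensor_def scaled_density_def split_beta power2_eq_square mult_ac)
qed

lemma coeff_density_in_class:
  assumes \<epsilon>: "\<bar>\<epsilon>\<bar> \<le> 1" and \<sigma>: "0 < \<sigma>" "\<sigma> \<le> 1" and \<tau>: "1 \<le> \<tau>"
    and \<alpha>: "\<alpha> > 0" and eq: "\<sigma> * \<tau> powr (1 + \<alpha>) \<le> 1"
    and cA: "2 * (deriv_bound (strict_floor \<alpha>))\<^sup>2 \<le> c\<^sub>A" and cB: "8 \<le> c\<^sub>B"
    and cM: "\<sigma> * \<tau> * (2 / fejer_mass)\<^sup>2 \<le> c\<^sub>M"
  shows "coeff_density \<sigma> \<tau> \<epsilon> \<in> coeff_class 0 \<alpha> c\<^sub>A c\<^sub>B r\<^sub>A c\<^sub>M"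
proof -
  let ?s = "strict_floor \<alpha>"
  have tower: "coeff_density \<sigma> \<tau> \<epsilon> = tensor (scaled_deriv 0 \<sigma> 0) (scaled_deriv \<epsilon> \<tau> 0)"
    by (simp add: coeff_density_def scaled_deriv_0)
  have "\<bar>(pderiv1 ^^ k) ((pderiv2 ^^ (?s - k)) (coeff_density \<sigma> \<tau> \<epsilon>)) p
         - (pderiv1 ^^ k) ((pderiv2 ^^ (?s - k)) (coeff_density \<sigma> \<tau> \<epsilon>)) 0\<bar>
       \<le> c\<^sub>A * norm (p - 0) powr (\<alpha> - real ?s)" if "k \<le> ?s" for k p
  proof -
    obtain x y where p: "p = (x, y)" by (cases p)
    have "\<bar>scaled_deriv 0 \<sigma> k x * scaled_deriv \<epsilon> \<tau> (?s - k) y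
          - scaled_deriv 0 \<sigma> k 0 * scaled_deriv \<epsilon> \<tau> (?s - k) 0\<bar>
        \<le> 2 * (deriv_bound ?s)\<^sup>2 * norm (x, y) powr (\<alpha> - real ?s)"
      using assms that by (intro scaled_deriv_hoelder) auto
    also have "\<dots> \<le> c\<^sub>A * norm (x, y) powr (\<alpha> - real ?s)"
      using cA by (intro mult_right_mono) auto
    finally show ?thesis
      unfolding tower
      by (subst (1 2) pderiv1_pderiv2_power_tensor[where G = "scaled_deriv 0 \<sigma>" and H = "scaled_deriv \<epsilon> \<tau>",
            OF scaled_deriv_Suc scaled_deriv_Suc])
         (simp add: tensor_def p zero_prod_def)
  qed
  moreover have "cont_differentiable_on ?s (coeff_density \<sigma> \<tau> \<epsilon>) (ball 0 r\<^sub>A)"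
    unfolding tower by (intro cont_differentiable_on_tensor scaled_deriv_Suc)
  moreover obtain g where "weak_gradient (char_fun (coeff_density \<sigma> \<tau> \<epsilon>)) g"
     "(\<integral>\<^sup>+x. esssup lborel (\<lambda>y. ennreal (norm (g (x, y)))) \<partial>lborel) \<le> ennreal 8"
    using char_fun_gradient_bound[OF \<epsilon> \<sigma> \<tau>] by blast
  moreover have "ennreal 8 \<le> ennreal c\<^sub>B" using cB by (rule ennreal_leI)
  moreover have "coeff_density \<sigma> \<tau> \<epsilon> b \<le> c\<^sub>M" for b
    using coeff_density_le[of \<epsilon> \<sigma> \<tau> b] \<epsilon> \<sigma> \<tau> cM by simp
  moreover have "prob_density (coeff_density \<sigma> \<tau> \<epsilon>)"
    using \<epsilon> \<sigma> \<tau> by (intro prob_density_coeff_density) auto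
  ultimately show ?thesis
    unfolding coeff_class_def Let_def using order_trans by blast
qed

section \<open>The law of the observations\<close>

lemma measurable_line [measurable]:
  "(\<lambda>a. fst a + snd a * x) \<in> borel_measurable (borel :: (real \<times> real) measure)"
  by (intro borel_measurable_continuous_onI continuous_intros)

text \<open>Given \<open>X = x\<close>, the characteristic function of the response \<open>A\<^sub>0 + A\<^sub>1 x\<close> at \<open>t\<close> is the one of the
coefficients at \<open>(t, t x)\<close>: observing \<open>x\<close> reveals exactly the values on the line of slope \<open>x\<close> through
the origin of the frequency plane.\<close>

lemma response_law_eq:
  assumes f: "prob_density f" and g: "prob_density g"
    and eq: "\<And>t. char_fun f (t, t * x) = char_fun g (t, t * x)"
  shows "distr (law_of_density f) borel (\<lambda>a. fst a + snd a * x)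
       = distr (law_of_density g) borel (\<lambda>a. fst a + snd a * x)"
proof (rule Levy_uniqueness)
  have line: "(\<lambda>a. fst a + snd a * x) \<in> borel_measurable (law_of_density f)" for f
    by (simp add: law_of_density_def)
  show "real_distribution (distr (law_of_density f) borel (\<lambda>a. fst a + snd a * x))"
       "real_distribution (distr (law_of_density g) borel (\<lambda>a. fst a + snd a * x))"
    using prob_space.real_distribution_distr[OF prob_space_law_of_density line] f g by auto
  have "char (distr (law_of_density f) borel (\<lambda>a. fst a + snd a * x)) t = char_fun f (t, t * x)" for f t
    unfolding char_def char_fun_def
    by (subst integral_distr[OF line])
      (auto intro!: Bochner_Integration.integral_cong arg_cong[where f = exp] simp: inner_prod_def algebra_simps)
  then show "char (distr (law_of_density f) borel (\<lambda>a. fst a + snd a * x))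
      = char (distr (law_of_density g) borel (\<lambda>a. fst a + snd a * x))"
    by (simp add: fun_eq_iff eq)
qed

definition datum :: "real \<times> (real \<times> real) \<Rightarrow> real \<times> real" where
  "datum = (\<lambda>(x, a). (x, fst a + snd a * x))"

definition datum_law :: "(real \<Rightarrow> real) \<Rightarrow> (real \<times> real \<Rightarrow> real) \<Rightarrow> (real \<times> real) measure" where
  "datum_law f\<^sub>X f = distr (law_of_density f\<^sub>X \<Otimes>\<^sub>M law_of_density f) borel datum"

lemma measurable_datum:
  "datum \<in> law_of_density f\<^sub>X \<Otimes>\<^sub>M law_of_density f \<rightarrow>\<^sub>M borel"
proof -
  have "continuous_on UNIV datum"
    unfolding datum_def split_beta by (intro continuous_intros)
  then have "datum \<in> borel_measurable borel" by (rule borel_measurable_continuous_onI)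
  then show ?thesis
    by (subst measurable_cong_sets[OF sets_pair_measure_cong[OF sets_law_of_density sets_law_of_density] refl])
      (simp add: borel_prod)
qed

lemma emeasure_datum_law:
  assumes B: "B \<in> sets borel" and f: "prob_density f"
  shows "emeasure (datum_law f\<^sub>X f) B =
    (\<integral>\<^sup>+x. emeasure (distr (law_of_density f) borel (\<lambda>a. fst a + snd a * x)) (Pair x -` B)
       \<partial>law_of_density f\<^sub>X)"
proof -
  interpret prob_space "law_of_density f" using f by (rule prob_space_law_of_density)
  have "emeasure (datum_law f\<^sub>X f) B
      = emeasure (law_of_density f\<^sub>X \<Otimes>\<^sub>M law_of_density f) (datum -` B)"
    unfolding datum_law_def using B
    by (subst emeasure_distr[OF measurable_datum]) (auto simp: space_pair_measure)
  also have "\<dots> = (\<integral>\<^sup>+x. emeasure (law_of_density f) (Pair x -` (datum -` B)) \<partial>law_of_density f\<^sub>X)"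
    using measurable_sets[OF measurable_datum B, of f\<^sub>X f]
    by (intro emeasure_pair_measure_alt) (simp add: space_pair_measure)
  also have "\<dots> = (\<integral>\<^sup>+x. emeasure (distr (law_of_density f) borel (\<lambda>a. fst a + snd a * x)) (Pair x -` B)
       \<partial>law_of_density f\<^sub>X)"
  proof (rule nn_integral_cong)
    fix x
    have "B \<in> sets (borel \<Otimes>\<^sub>M borel)" unfolding borel_prod by (rule B)
    then have "Pair x -` B \<in> sets borel" by (rule sets_Pair1)
    then show "emeasure (law_of_density f) (Pair x -` (datum -` B))
        = emeasure (distr (law_of_density f) borel (\<lambda>a. fst a + snd a * x)) (Pair x -` B)"
      by (subst emeasure_distr) (auto simp: law_of_density_def datum_def intro!: arg_cong2[where f = emeasure])
  qed
  finally show ?thesis .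
qed

text \<open>Conditionally on a design point in \<open>S\<close> the two response laws are identical, so a Fubini
decomposition over the design equates the joint laws on \<open>S \<times> \<real>\<close>.\<close>

lemma datum_law_eq_on_strip:
  assumes f: "prob_density f" and g: "prob_density g"
    and eq: "\<And>x t. x \<in> S \<Longrightarrow> char_fun f (t, t * x) = char_fun g (t, t * x)"
    and B: "B \<in> sets borel" "B \<subseteq> S \<times> UNIV"
  shows "emeasure (datum_law f\<^sub>X f) B = emeasure (datum_law f\<^sub>X g) B"
  unfolding emeasure_datum_law[OF B(1) f] emeasure_datum_law[OF B(1) g]
proof (rule nn_integral_cong)
  fix x
  show "emeasure (distr (law_of_density f) borel (\<lambda>a. fst a + snd a * x)) (Pair x -` B)
      = emeasure (distr (law_of_density g) borel (\<lambda>a. fst a + snd a * x)) (Pair x -` B)"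
  proof (cases "x \<in> S")
    case True
    with response_law_eq[OF f g eq] show ?thesis by simp
  next
    case False
    then have "Pair x -` B = {}" using B(2) by auto
    then show ?thesis by simp
  qed
qed

lemma emeasure_datum_law_strip:
  assumes f: "prob_density f" and S: "S \<in> sets borel"
  shows "emeasure (datum_law f\<^sub>X f) (S \<times> UNIV) = emeasure (law_of_density f\<^sub>X) S"
proof -
  interpret prob_space "law_of_density f" using f by (rule prob_space_law_of_density)
  have "datum -` (S \<times> UNIV) = S \<times> UNIV" by (auto simp: datum_def)
  moreover have "S \<times> (UNIV :: real set) \<in> sets borel"
    using S by (simp add: borel_prod[symmetric])
  ultimately have "emeasure (datum_law f\<^sub>X f) (S \<times> UNIV)
      = emeasure (law_of_density f\<^sub>X \<Otimes>\<^sub>M law_of_density f) (S \<times> UNIV)"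
    unfolding datum_law_def by (subst emeasure_distr[OF measurable_datum]) (auto simp: space_pair_measure)
  also have "\<dots> = emeasure (law_of_density f\<^sub>X) S"
    using emeasure_pair_measure_Times[of S "law_of_density f\<^sub>X" UNIV] S emeasure_space_1 by simp
  finally show ?thesis .
qed

lemma prob_space_datum_law:
  assumes "prob_density f\<^sub>X" "prob_density f" shows "prob_space (datum_law f\<^sub>X f)"
proof -
  interpret A: prob_space "law_of_density f" using assms by (intro prob_space_law_of_density)
  interpret X: prob_space "law_of_density f\<^sub>X" using assms by (intro prob_space_law_of_density)
  interpret pair_prob_space "law_of_density f\<^sub>X" "law_of_density f" ..
  show ?thesis unfolding datum_law_def by (rule prob_space_distr[OF measurable_datum])
qed

lemma sets_datum_law [simp, measurable_cong]: "sets (datum_law f\<^sub>X f) = sets borel"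
  by (simp add: datum_law_def)

lemma space_datum_law [simp]: "space (datum_law f\<^sub>X f) = UNIV"
  by (simp add: datum_law_def)

lemma observations_eq: "observations n \<omega> = (\<lambda>j\<in>{..<n}. datum (\<omega> j))"
  by (auto simp: observations_def datum_def design_def response_def coefficients_def split_beta)

lemma measurable_observations:
  "observations n \<in> rcr_space f\<^sub>X f \<rightarrow>\<^sub>M PiM {..<n} (\<lambda>_. borel)"
  unfolding observations_eq[abs_def] rcr_space_def
proof (rule measurable_restrict)
  fix j
  have "(\<lambda>\<omega>. \<omega> j) \<in> PiM UNIV (\<lambda>_. law_of_density f\<^sub>X \<Otimes>\<^sub>M law_of_density f)
      \<rightarrow>\<^sub>M law_of_density f\<^sub>X \<Otimes>\<^sub>M law_of_density f"
    by (rule measurable_component_singleton) simp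
  then show "(\<lambda>\<omega>. datum (\<omega> j)) \<in> PiM UNIV (\<lambda>_. law_of_density f\<^sub>X \<Otimes>\<^sub>M law_of_density f) \<rightarrow>\<^sub>M borel"
    using measurable_datum by (rule measurable_compose)
qed

lemma distr_observations:
  assumes fX: "prob_density f\<^sub>X" and f: "prob_density f"
  shows "distr (rcr_space f\<^sub>X f) (PiM {..<n} (\<lambda>_. borel)) (observations n)
       = PiM {..<n} (\<lambda>_. datum_law f\<^sub>X f)"
proof -
  let ?M = "law_of_density f\<^sub>X \<Otimes>\<^sub>M law_of_density f"
  interpret A: prob_space "law_of_density f" using f by (rule prob_space_law_of_density)
  interpret X: prob_space "law_of_density f\<^sub>X" using fX by (rule prob_space_law_of_density)
  interpret pair_prob_space "law_of_density f\<^sub>X" "law_of_density f" ..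
  interpret M: product_prob_space "\<lambda>_::nat. ?M" UNIV ..
  interpret D: prob_space "datum_law f\<^sub>X f" using fX f by (rule prob_space_datum_law)
  interpret D: product_prob_space "\<lambda>_::nat. datum_law f\<^sub>X f" "{..<n}" ..
  show ?thesis
  proof (rule D.PiM_eqI)
    show "finite {..<n}" by simp
    show "sets (distr (rcr_space f\<^sub>X f) (PiM {..<n} (\<lambda>_. borel)) (observations n))
        = sets (PiM {..<n} (\<lambda>_. datum_law f\<^sub>X f))"
      by (simp cong: sets_PiM_cong)
    fix A assume "\<And>i. i \<in> {..<n} \<Longrightarrow> A i \<in> sets (datum_law f\<^sub>X f)"
    then have A: "A i \<in> sets borel" if "i < n" for i using that by simp
    have "observations n -` Pi\<^sub>E {..<n} A \<inter> space (rcr_space f\<^sub>X f)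
        = prod_emb UNIV (\<lambda>_. ?M) {..<n} (Pi\<^sub>E {..<n} (\<lambda>i. datum -` A i \<inter> space ?M))"
      by (auto simp: observations_eq rcr_space_def prod_emb_def space_PiM space_pair_measure PiE_iff)
    then have "emeasure (distr (rcr_space f\<^sub>X f) (PiM {..<n} (\<lambda>_. borel)) (observations n)) (Pi\<^sub>E {..<n} A)
        = emeasure (PiM UNIV (\<lambda>_. ?M)) (prod_emb UNIV (\<lambda>_. ?M) {..<n} (Pi\<^sub>E {..<n} (\<lambda>i. datum -` A i \<inter> space ?M)))"
      using A by (subst emeasure_distr[OF measurable_observations])
        (auto intro!: sets_PiM_I_finite simp: rcr_space_def)
    also have "\<dots> = (\<Prod>i<n. emeasure ?M (datum -` A i \<inter> space ?M))"
      using A by (intro M.emeasure_PiM_emb measurable_sets[OF measurable_datum]) auto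
    also have "\<dots> = (\<Prod>i<n. emeasure (datum_law f\<^sub>X f) (A i))"
      unfolding datum_law_def using A by (intro prod.cong refl emeasure_distr[OF measurable_datum, symmetric]) auto
    finally show "emeasure (distr (rcr_space f\<^sub>X f) (PiM {..<n} (\<lambda>_. borel)) (observations n)) (Pi\<^sub>E {..<n} A)
        = (\<Prod>i<n. emeasure (datum_law f\<^sub>X f) (A i))" .
  qed
qed

text \<open>Two laws that agree on the subsets of \<open>S\<close> have product laws that agree on the subsets of \<open>S\<^sup>n\<close>, since
boxes determine a finite measure on the product.\<close>

lemma restricted_product_law_eq:
  fixes n :: nat and M N :: "'a::topological_space measure"
  assumes f: "prob_space M" "sets M = sets borel" and g: "prob_space N" "sets N = sets borel"
    and S: "S \<in> sets borel"
    and eq: "\<And>B. B \<in> sets borel \<Longrightarrow> B \<subseteq> S \<Longrightarrow> emeasure M B = emeasure N B"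
  shows "density (PiM {..<n} (\<lambda>_. M)) (indicator (Pi\<^sub>E {..<n} (\<lambda>_. S)))
       = density (PiM {..<n} (\<lambda>_. N)) (indicator (Pi\<^sub>E {..<n} (\<lambda>_. S)))"
    (is "?L = ?R")
proof -
  interpret M: prob_space M by fact
  interpret N: prob_space N by fact
  interpret PM: product_prob_space "\<lambda>_::nat. M" "{..<n}" ..
  interpret PN: product_prob_space "\<lambda>_::nat. N" "{..<n}" ..
  have box: "emeasure (density (PiM {..<n} (\<lambda>_. K)) (indicator (Pi\<^sub>E {..<n} (\<lambda>_. S)))) (Pi\<^sub>E {..<n} A)
      = (\<Prod>i<n. emeasure K (S \<inter> A i))"
    if K: "prob_space K" "sets K = sets borel" and A: "\<And>i. i < n \<Longrightarrow> A i \<in> sets borel" for K :: "'a measure" and A :: "nat \<Rightarrow> 'a set"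
  proof -
    interpret K: prob_space K by fact
    interpret PK: product_prob_space "\<lambda>_::nat. K" "{..<n}" ..
    have "emeasure (density (PiM {..<n} (\<lambda>_. K)) (indicator (Pi\<^sub>E {..<n} (\<lambda>_. S)))) (Pi\<^sub>E {..<n} A)
        = emeasure (PiM {..<n} (\<lambda>_. K)) (Pi\<^sub>E {..<n} (\<lambda>i. S \<inter> A i))"
      using S A K by (subst emeasure_restricted) (auto intro!: sets_PiM_I_finite simp: PiE_Int)
    also have "\<dots> = (\<Prod>i<n. emeasure K (S \<inter> A i))"
      using S A K by (intro PK.emeasure_PiM) auto
    finally show ?thesis .
  qed
  show ?thesis
  proof (rule measure_eqI_PiM_finite[where I = "{..<n}" and M = "\<lambda>_. borel"])
    show "sets ?L = sets (PiM {..<n} (\<lambda>_. borel))" "sets ?R = sets (PiM {..<n} (\<lambda>_. borel))"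
      using f(2) g(2) by (simp_all cong: sets_PiM_cong)
    fix A :: "nat \<Rightarrow> 'a set" assume "\<And>i. i \<in> {..<n} \<Longrightarrow> A i \<in> sets borel"
    then have A: "\<And>i. i < n \<Longrightarrow> A i \<in> sets borel" by simp
    show "emeasure ?L (Pi\<^sub>E {..<n} A) = emeasure ?R (Pi\<^sub>E {..<n} A)"
    proof -
      have "emeasure ?L (Pi\<^sub>E {..<n} A) = (\<Prod>i<n. emeasure M (S \<inter> A i))" by (rule box[OF f]) (rule A)
      also have "\<dots> = (\<Prod>i<n. emeasure N (S \<inter> A i))" using A S by (intro prod.cong eq) auto
      also have "\<dots> = emeasure ?R (Pi\<^sub>E {..<n} A)" by (rule box[OF g, symmetric]) (rule A)
      finally show ?thesis .
    qed
  next
    let ?U = "\<lambda>_::nat. Pi\<^sub>E {..<n} (\<lambda>_. UNIV)"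
    show "range ?U \<subseteq> prod_algebra {..<n} (\<lambda>_. borel)"
      by (auto intro!: prod_algebraI_finite)
    show "(\<Union>i. ?U i) = space (PiM {..<n} (\<lambda>_. borel))" by (simp add: space_PiM)
    show "emeasure ?L (?U i) \<noteq> \<infinity>" for i
      using S f(2) by (subst box[OF f]) (auto simp: power_eq_top_ennreal)
  qed simp
qed

text \<open>Le Cam's two-point argument. Restricted to the event that all design points lie in \<open>S\<close>, the law of
the data is the same finite measure \<open>Q\<close> under both densities. One estimate cannot
be close to both values: \<open>(t - p)\<^sup>2 + (t - q)\<^sup>2 \<ge> (p - q)\<^sup>2 / 2\<close>. The mass of \<open>Q\<close> is the probability of the
event.\<close>

lemma two_point_risk_bound:
  assumes fX: "prob_density f\<^sub>X" and f: "prob_density f" and g: "prob_density g"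
    and S: "S \<in> sets borel"
    and eq: "\<And>x t. x \<in> S \<Longrightarrow> char_fun f (t, t * x) = char_fun g (t, t * x)"
    and T: "estimator n T"
  shows "ennreal ((f b - g b)\<^sup>2 / 2) * emeasure (law_of_density f\<^sub>X) S ^ n
     \<le> pointwise_risk f\<^sub>X f n T b + pointwise_risk f\<^sub>X g n T b"
proof -
  let ?E = "Pi\<^sub>E {..<n} (\<lambda>_. S \<times> (UNIV :: real set))"
  let ?P = "\<lambda>h. PiM {..<n} (\<lambda>_. datum_law f\<^sub>X h)"
  have strip: "S \<times> (UNIV :: real set) \<in> sets borel" using S by (simp add: borel_prod[symmetric])
  have Tm: "(\<lambda>d. T d b) \<in> borel_measurable (PiM {..<n} (\<lambda>_. borel))"
    using T unfolding estimator_def by blast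
  have setsP: "sets (?P h) = sets (PiM {..<n} (\<lambda>_. borel))" for h by (simp cong: sets_PiM_cong)
  have E: "?E \<in> sets (PiM {..<n} (\<lambda>_. borel))"
    using strip by (intro sets_PiM_I_finite) auto
  define Q where "Q = density (?P f) (indicator ?E)"
  have Q: "Q = density (?P h) (indicator ?E)" if "h = f \<or> h = g" for h
    using that unfolding Q_def
    by (auto intro!: restricted_product_law_eq prob_space_datum_law fX f g strip
        datum_law_eq_on_strip[OF f g eq])
  have setsQ: "sets Q = sets (PiM {..<n} (\<lambda>_. borel))" by (simp add: Q_def setsP)
  have Tq: "(\<lambda>d. ennreal (\<bar>T d b - c\<bar>\<^sup>2)) \<in> borel_measurable (PiM {..<n} (\<lambda>_. borel))" for c
    using Tm by measurable
  have risk: "(\<integral>\<^sup>+d. ennreal (\<bar>T d b - h b\<bar>\<^sup>2) \<partial>Q) \<le> pointwise_risk f\<^sub>X h n T b"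
    if h: "h = f \<or> h = g" for h
  proof -
    have "prob_density h" using h f g by auto
    have "(\<integral>\<^sup>+d. ennreal (\<bar>T d b - h b\<bar>\<^sup>2) \<partial>Q)
        = (\<integral>\<^sup>+d. indicator ?E d * ennreal (\<bar>T d b - h b\<bar>\<^sup>2) \<partial>?P h)"
      unfolding Q[OF h] using E Tq[of "h b"]
      by (intro nn_integral_density) (simp_all add: setsP measurable_cong_sets[OF setsP refl])
    also have "\<dots> \<le> (\<integral>\<^sup>+d. ennreal (\<bar>T d b - h b\<bar>\<^sup>2) \<partial>?P h)"
      by (intro nn_integral_mono) (auto simp: indicator_def)
    also have "\<dots> = pointwise_risk f\<^sub>X h n T b"
      unfolding pointwise_risk_def distr_observations[OF fX \<open>prob_density h\<close>, symmetric]
      by (rule nn_integral_distr[OF measurable_observations]) (use Tq[of "h b"] in simp)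
    finally show ?thesis .
  qed
  have "emeasure Q (space Q) = emeasure (?P f) ?E"
  proof -
    have E': "?E \<in> sets (?P f)" using E by (simp only: setsP)
    then have "?E \<inter> space (?P f) = ?E" by (rule Int_absorb2[OF sets.sets_into_space])
    then show ?thesis
      unfolding Q_def space_density emeasure_restricted[OF E' sets.top] by simp
  qed
  also have "\<dots> = emeasure (law_of_density f\<^sub>X) S ^ n"
  proof -
    interpret D: prob_space "datum_law f\<^sub>X f" using fX f by (rule prob_space_datum_law)
    interpret D: product_prob_space "\<lambda>_::nat. datum_law f\<^sub>X f" "{..<n}" ..
    show ?thesis using strip by (simp add: D.emeasure_PiM emeasure_datum_law_strip[OF f S])
  qed
  finally have mass: "emeasure Q (space Q) = emeasure (law_of_density f\<^sub>X) S ^ n" .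
  have "ennreal ((f b - g b)\<^sup>2 / 2) * emeasure Q (space Q) = (\<integral>\<^sup>+d. ennreal ((f b - g b)\<^sup>2 / 2) \<partial>Q)"
    by simp
  also have "\<dots> \<le> (\<integral>\<^sup>+d. ennreal (\<bar>T d b - f b\<bar>\<^sup>2) + ennreal (\<bar>T d b - g b\<bar>\<^sup>2) \<partial>Q)"
  proof (rule nn_integral_mono)
    fix d
    \<comment> \<open>The midpoint of the two values minimises the sum of the squared errors.\<close>
    have "0 \<le> (2 * T d b - f b - g b)\<^sup>2" by simp
    then have "(f b - g b)\<^sup>2 / 2 \<le> \<bar>T d b - f b\<bar>\<^sup>2 + \<bar>T d b - g b\<bar>\<^sup>2"
      by (simp add: power2_eq_square field_simps)
    then have "ennreal ((f b - g b)\<^sup>2 / 2) \<le> ennreal (\<bar>T d b - f b\<bar>\<^sup>2 + \<bar>T d b - g b\<bar>\<^sup>2)"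
      by (rule ennreal_leI)
    then show "ennreal ((f b - g b)\<^sup>2 / 2) \<le> ennreal (\<bar>T d b - f b\<bar>\<^sup>2) + ennreal (\<bar>T d b - g b\<bar>\<^sup>2)"
      by (subst ennreal_plus[symmetric]) simp_all
  qed
  also have "\<dots> = (\<integral>\<^sup>+d. ennreal (\<bar>T d b - f b\<bar>\<^sup>2) \<partial>Q) + (\<integral>\<^sup>+d. ennreal (\<bar>T d b - g b\<bar>\<^sup>2) \<partial>Q)"
    using Tq by (intro nn_integral_add) (simp_all add: measurable_cong_sets[OF setsQ refl])
  also have "\<dots> \<le> pointwise_risk f\<^sub>X f n T b + pointwise_risk f\<^sub>X g n T b"
    by (intro add_mono risk) auto
  finally show ?thesis by (simp add: mass)
qed

section \<open>Choice of the scales and the rate\<close>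

lemma nn_integral_powr_tail:
  assumes \<gamma>: "\<gamma> > 0" and R: "R > 0"
  shows "(\<integral>\<^sup>+x. ennreal ((1 + x) powr (- \<gamma> - 1)) * indicator {R..} x \<partial>lborel) \<le> ennreal (R powr (- \<gamma>) / \<gamma>)"
proof -
  let ?F = "\<lambda>x. - ((1 + x) powr (- \<gamma>)) / \<gamma>"
  have "(\<integral>\<^sup>+x. ennreal ((1 + x) powr (- \<gamma> - 1)) * indicator {R..} x \<partial>lborel) = ennreal (0 - ?F R)"
  proof (rule nn_integral_FTC_atLeast)
    show "(?F has_real_derivative (1 + x) powr (- \<gamma> - 1)) (at x)" if "R \<le> x" for x
      using that R \<gamma> by (auto intro!: derivative_eq_intros)
    have "((\<lambda>x. (1 + x) powr (- \<gamma>)) \<longlongrightarrow> 0) at_top"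
      using \<gamma> by (intro tendsto_neg_powr filterlim_tendsto_add_at_top[OF tendsto_const] filterlim_ident) auto
    from tendsto_divide[OF tendsto_minus[OF this] tendsto_const[of \<gamma>]] \<gamma>
    show "(?F \<longlongrightarrow> 0) at_top" by simp
  qed auto
  also have "\<dots> \<le> ennreal (R powr (- \<gamma>) / \<gamma>)"
    using \<gamma> R by (intro ennreal_leI) (auto intro!: divide_right_mono powr_mono2')
  finally show ?thesis .
qed

lemma prob_abs_design_le:
  assumes fX: "prob_density f\<^sub>X" and \<gamma>: "\<gamma> > 0" and R: "R > 0" and C: "C \<ge> 0"
    and tail: "\<And>x. f\<^sub>X x \<le> C * (1 + \<bar>x\<bar>) powr (- \<gamma> - 1)"
  shows "ennreal (1 - 2 * C * R powr (- \<gamma>) / \<gamma>) \<le> emeasure (law_of_density f\<^sub>X) {-R..R}"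
proof -
  interpret prob_space "law_of_density f\<^sub>X" using fX by (rule prob_space_law_of_density)
  have [measurable]: "f\<^sub>X \<in> borel_measurable borel" using fX by (simp add: prob_density_def)
  let ?h = "\<lambda>x. ennreal ((1 + x) powr (- \<gamma> - 1)) * indicator {R..} x"
  let ?I = "\<integral>\<^sup>+x. ?h x \<partial>lborel"
  have "emeasure (law_of_density f\<^sub>X) (- {-R..R}) = (\<integral>\<^sup>+x. ennreal (f\<^sub>X x) * indicator (- {-R..R}) x \<partial>lborel)"
    unfolding law_of_density_def by (rule emeasure_density) auto
  also have "\<dots> \<le> (\<integral>\<^sup>+x. ennreal C * (?h x + ?h (0 + - 1 * x)) \<partial>lborel)"
  proof (rule nn_integral_mono)
    fix x
    have "ennreal (f\<^sub>X x) \<le> ennreal C * ennreal ((1 + \<bar>x\<bar>) powr (- \<gamma> - 1))"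
      using tail[of x] C by (subst ennreal_mult[symmetric]) (auto intro!: ennreal_leI)
    then show "ennreal (f\<^sub>X x) * indicator (- {-R..R}) x \<le> ennreal C * (?h x + ?h (0 + - 1 * x))"
      using R by (cases "x \<ge> 0") (auto simp: indicator_def)
  qed
  also have "\<dots> = ennreal C * (?I + (\<integral>\<^sup>+x. ?h (0 + - 1 * x) \<partial>lborel))"
    by (subst nn_integral_cmult, measurable) (subst nn_integral_add, measurable)
  also have "(\<integral>\<^sup>+x. ?h (0 + - 1 * x) \<partial>lborel) = ?I"
    using nn_integral_real_affine[of ?h "-1" 0] by simp
  also have "ennreal C * (?I + ?I) \<le> ennreal C * (ennreal (R powr (- \<gamma>) / \<gamma>) + ennreal (R powr (- \<gamma>) / \<gamma>))"
    by (intro mult_left_mono add_mono nn_integral_powr_tail \<gamma> R) auto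
  also have "\<dots> = ennreal (2 * C * R powr (- \<gamma>) / \<gamma>)"
    using C \<gamma> by (simp flip: ennreal_plus ennreal_mult)
  finally have "prob (- {-R..R}) \<le> 2 * C * R powr (- \<gamma>) / \<gamma>"
    using C \<gamma> by (simp add: emeasure_eq_measure)
  moreover have "prob (- {-R..R}) = 1 - prob {-R..R}"
    using prob_compl[of "{-R..R}"] by (simp add: Compl_eq_Diff_UNIV)
  ultimately show ?thesis by (simp add: emeasure_eq_measure)
qed

text \<open>The characteristic functions of the two densities differ at \<open>(t, t x)\<close> by a multiple of
\<open>tent (t / \<sigma>)\<close> times the sum of the tents centred at \<open>- 2\<close> and \<open>2\<close>, evaluated at \<open>t x / \<tau>\<close>. If the first factor is
nonzero, then \<open>\<bar>t\<bar> < \<sigma>\<close>, hence \<open>\<bar>t x / \<tau>\<bar> < 1\<close>, and both tents vanish.\<close>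

lemma char_fun_coeff_density_agree:
  assumes "0 < \<sigma>" "0 < \<tau>" "\<bar>x\<bar> \<le> \<tau> / \<sigma>"
  shows "char_fun (coeff_density \<sigma> \<tau> 0) (t, t * x) = char_fun (coeff_density \<sigma> \<tau> 1) (t, t * x)"
proof (cases "\<bar>t / \<sigma>\<bar> < 1")
  case True
  have "\<bar>t * x / \<tau>\<bar> = \<bar>t\<bar> * \<bar>x\<bar> / \<tau>" using assms by (simp add: abs_mult)
  also have "\<dots> \<le> \<bar>t\<bar> * (\<tau> / \<sigma>) / \<tau>" using assms by (intro divide_right_mono mult_left_mono) auto
  also have "\<dots> = \<bar>t / \<sigma>\<bar>" using assms by (simp add: abs_divide)
  finally have "\<bar>t * x / \<tau>\<bar> < 1" using True by simp
  then have "tent (t * x / \<tau> + 2) = 0" "tent (t * x / \<tau> - 2) = 0"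
    by (intro tent_eq_0; linarith)+
  with assms show ?thesis by (simp add: char_fun_coeff_density tensor_def band_char_def)
next
  case False
  with assms show ?thesis by (simp add: char_fun_coeff_density tensor_def band_char_def tent_eq_0)
qed

lemma coeff_density_at_0: "coeff_density \<sigma> \<tau> \<epsilon> 0 = \<sigma> * \<tau> * (1 + \<epsilon>) / (2 * fejer_mass)\<^sup>2"
  by (simp add: coeff_density_def tensor_def scaled_density_def band_density_def fejer_def
      zero_prod_def power2_eq_square)

lemma SUP_risk_lower_bound:
  fixes r :: "'a \<Rightarrow> ennreal"
  assumes "f \<in> A" "g \<in> A" "ennreal d \<le> r f + r g" "0 \<le> d"
  shows "ennreal (d / 2) \<le> (SUP h\<in>A. r h)"
proof -
  define s where "s = (SUP h\<in>A. r h)"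
  have "r f + r g \<le> s + s"
    unfolding s_def using assms by (intro add_mono SUP_upper)
  with assms(3) have "ennreal d \<le> s + s" by (rule order_trans)
  then have "ennreal (d / 2) \<le> s"
    using assms(4) by (cases s rule: ennreal_cases) (auto simp flip: ennreal_plus)
  then show ?thesis by (simp only: s_def)
qed

text \<open>With \<open>\<sigma> = \<tau>\<^sup>-\<^sup>(\<^sup>1\<^sup>+\<^sup>\<alpha>\<^sup>)\<close> the design points carrying information satisfy \<open>\<bar>X\<bar> > \<tau> / \<sigma> = \<tau>\<^sup>\<alpha>\<^sup>+\<^sup>2\<close>. The
exponent \<open>\<rho>\<close> makes this threshold equal to \<open>n\<close> to the power \<open>1 / (\<beta> + 1)\<close>, so that each design point
exceeds it with probability of order \<open>1 / n\<close>. The densities differ at \<open>0\<close> by a multiple of \<open>\<sigma> \<tau> = \<tau>\<^sup>-\<^sup>\<alpha>\<close>, whose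
square is exactly compensated by the normalising power of \<open>n\<close>.\<close>

lemma risk_lower_bound:
  fixes \<alpha> \<beta> :: real and n :: nat
  assumes \<alpha>: "\<alpha> > 0" and \<beta>: "\<beta> > - 1"
    and fX: "prob_density f\<^sub>X" and C: "C \<ge> 0"
    and tail: "\<And>x. f\<^sub>X x \<le> C * (1 + \<bar>x\<bar>) powr (- \<beta> - 2)"
    and T: "estimator n T" and n: "n \<ge> 1" "2 * C / (\<beta> + 1) \<le> real n"
    and cA: "2 * (deriv_bound (strict_floor \<alpha>))\<^sup>2 \<le> c\<^sub>A" and cB: "8 \<le> c\<^sub>B"
    and cM: "real n powr (- \<alpha> / ((\<alpha> + 2) * (\<beta> + 1))) * (2 / fejer_mass)\<^sup>2 \<le> c\<^sub>M"
  shows "ennreal ((1 - 2 * C / (\<beta> + 1) / real n) ^ n / (4 * (2 * fejer_mass) ^ 4))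
    \<le> ennreal (real n powr (2 * \<alpha> / ((\<alpha> + 2) * (\<beta> + 1)))) *
        (SUP f\<in>coeff_class 0 \<alpha> c\<^sub>A c\<^sub>B r\<^sub>A c\<^sub>M. pointwise_risk f\<^sub>X f n T 0)"
proof -
  define \<rho> where "\<rho> = 1 / ((\<alpha> + 2) * (\<beta> + 1))"
  define \<tau> where "\<tau> = real n powr \<rho>"
  define \<sigma> where "\<sigma> = \<tau> powr (- (1 + \<alpha>))"
  define R where "R = \<tau> / \<sigma>"
  define p where "p = 1 - 2 * C / (\<beta> + 1) / real n"
  have \<rho>: "\<rho> > 0" using \<alpha> \<beta> by (simp add: \<rho>_def)
  have \<tau>: "1 \<le> \<tau>" unfolding \<tau>_def using n \<rho> by (intro ge_one_powr_ge_zero) auto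
  then have \<tau>0: "0 < \<tau>" by linarith
  have \<sigma>: "0 < \<sigma>" using \<tau> by (simp add: \<sigma>_def)
  have "\<tau> powr (- (1 + \<alpha>)) \<le> \<tau> powr 0" using \<tau> \<alpha> by (intro powr_mono) auto
  then have \<sigma>1: "\<sigma> \<le> 1" using \<tau> by (simp add: \<sigma>_def)
  have scale: "\<sigma> * \<tau> powr (1 + \<alpha>) = 1"
    unfolding \<sigma>_def using \<tau> by (simp flip: powr_add)
  have \<sigma>\<tau>: "\<sigma> * \<tau> = real n powr (- \<alpha> / ((\<alpha> + 2) * (\<beta> + 1)))"
  proof -
    have "\<sigma> * \<tau> = \<tau> powr (- (1 + \<alpha>)) * \<tau> powr 1" using \<tau>0 by (simp add: \<sigma>_def)
    also have "\<dots> = \<tau> powr (- \<alpha>)" unfolding powr_add[symmetric] by simp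
    also have "\<dots> = real n powr (- \<alpha> / ((\<alpha> + 2) * (\<beta> + 1)))"
      by (simp add: \<tau>_def powr_powr \<rho>_def)
    finally show ?thesis .
  qed
  have R: "R > 0" using \<tau> \<sigma> by (simp add: R_def)
  have R_eq: "R powr (- (\<beta> + 1)) = 1 / real n"
  proof -
    have "R = \<tau> powr 1 / \<tau> powr (- (1 + \<alpha>))" using \<tau>0 by (simp add: R_def \<sigma>_def)
    also have "\<dots> = \<tau> powr (\<alpha> + 2)" unfolding powr_diff[symmetric] by (simp add: add.commute)
    finally have "R powr (- (\<beta> + 1)) = real n powr (- (\<rho> * ((\<alpha> + 2) * (\<beta> + 1))))"
      by (simp add: \<tau>_def powr_powr algebra_simps)
    also have "\<rho> * ((\<alpha> + 2) * (\<beta> + 1)) = 1" using \<alpha> \<beta> by (simp add: \<rho>_def)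
    finally show ?thesis using n by (simp add: powr_minus_divide)
  qed
  have "2 * C / (\<beta> + 1) / real n \<le> 1" using n by (subst pos_divide_le_eq) auto
  then have p0: "0 \<le> p" by (simp add: p_def)
  have design: "ennreal p \<le> emeasure (law_of_density f\<^sub>X) {-R..R}"
  proof -
    have "ennreal (1 - 2 * C * R powr (- (\<beta> + 1)) / (\<beta> + 1)) \<le> emeasure (law_of_density f\<^sub>X) {-R..R}"
      using \<beta> tail by (intro prob_abs_design_le fX R C) (auto simp: algebra_simps)
    then show ?thesis by (simp only: R_eq p_def) (simp add: mult_ac)
  qed
  let ?f = "\<lambda>\<epsilon>. coeff_density \<sigma> \<tau> \<epsilon>"
  let ?A = "coeff_class 0 \<alpha> c\<^sub>A c\<^sub>B r\<^sub>A c\<^sub>M"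
  let ?d = "(?f 0 0 - ?f 1 0)\<^sup>2 / 2"
  have mem: "?f \<epsilon> \<in> ?A" if "\<bar>\<epsilon>\<bar> \<le> 1" for \<epsilon>
    using that \<sigma> \<sigma>1 \<tau> \<alpha> cA cB cM scale by (intro coeff_density_in_class) (auto simp: \<sigma>\<tau>)
  have "ennreal (?d * p ^ n) = ennreal ?d * ennreal p ^ n"
    using p0 by (subst ennreal_mult) (auto simp: ennreal_power)
  also have "\<dots> \<le> ennreal ?d * emeasure (law_of_density f\<^sub>X) {-R..R} ^ n"
    using design by (intro mult_left_mono power_mono) auto
  also have "\<dots> \<le> pointwise_risk f\<^sub>X (?f 0) n T 0 + pointwise_risk f\<^sub>X (?f 1) n T 0"
  proof (rule two_point_risk_bound[OF fX])
    show "prob_density (?f 0)" "prob_density (?f 1)"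
      using \<sigma> \<tau> by (auto intro!: prob_density_coeff_density)
    show "char_fun (?f 0) (t, t * x) = char_fun (?f 1) (t, t * x)" if "x \<in> {-R..R}" for x t
      using that \<sigma> \<tau> by (intro char_fun_coeff_density_agree) (auto simp: R_def)
  qed (use T in auto)
  finally have "ennreal (?d * p ^ n / 2) \<le> (SUP f\<in>?A. pointwise_risk f\<^sub>X f n T 0)"
    using mem[of 0] mem[of 1] p0 by (intro SUP_risk_lower_bound[of "?f 0" _ "?f 1"]) auto
  then have "ennreal (real n powr (2 * \<alpha> * \<rho>)) * ennreal (?d * p ^ n / 2)
      \<le> ennreal (real n powr (2 * \<alpha> * \<rho>)) * (SUP f\<in>?A. pointwise_risk f\<^sub>X f n T 0)"
    by (rule mult_left_mono) simp
  moreover have "real n powr (2 * \<alpha> * \<rho>) * (?d * p ^ n / 2) = p ^ n / (4 * (2 * fejer_mass) ^ 4)"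
  proof -
    have d: "?d = (\<sigma> * \<tau>)\<^sup>2 / (2 * (2 * fejer_mass) ^ 4)"
      by (simp add: coeff_density_at_0 power2_eq_square power4_eq_xxxx field_simps)
    have e: "- \<alpha> / ((\<alpha> + 2) * (\<beta> + 1)) = - (\<alpha> * \<rho>)" by (simp add: \<rho>_def)
    have "(\<sigma> * \<tau>)\<^sup>2 = real n powr (- (\<alpha> * \<rho>) + - (\<alpha> * \<rho>))"
      unfolding \<sigma>\<tau> e power2_eq_square powr_add ..
    then have "real n powr (2 * \<alpha> * \<rho>) * (\<sigma> * \<tau>)\<^sup>2
        = real n powr (2 * \<alpha> * \<rho> + (- (\<alpha> * \<rho>) + - (\<alpha> * \<rho>)))"
      by (simp only: powr_add)
    also have "\<dots> = 1" using n by simp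
    finally have one: "real n powr (2 * \<alpha> * \<rho>) * (\<sigma> * \<tau>)\<^sup>2 = 1" .
    have "real n powr (2 * \<alpha> * \<rho>) * (?d * p ^ n / 2)
        = (real n powr (2 * \<alpha> * \<rho>) * (\<sigma> * \<tau>)\<^sup>2) * (p ^ n / (4 * (2 * fejer_mass) ^ 4))"
      unfolding d by simp
    then show ?thesis unfolding one by simp
  qed
  ultimately show ?thesis
    using p0 by (simp add: ennreal_mult[symmetric] p_def \<rho>_def)
qed

theorem theorem3p2:
  fixes \<alpha> \<beta> :: real
  assumes "\<alpha> > 0" and "\<beta> > 1"
  shows "\<exists>C\<^sub>A C\<^sub>B :: real. \<forall>c\<^sub>A c\<^sub>B r\<^sub>A c\<^sub>M c\<^sub>X C\<^sub>X :: real.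
    \<forall>(f\<^sub>X :: real \<Rightarrow> real) (fhat :: nat \<Rightarrow> (nat \<Rightarrow> real \<times> real) \<Rightarrow> real \<times> real \<Rightarrow> real).
      c\<^sub>A \<ge> C\<^sub>A \<and> c\<^sub>B \<ge> C\<^sub>B \<and> r\<^sub>A > 0 \<and> c\<^sub>M > 0 \<and> c\<^sub>X > 0 \<and> C\<^sub>X > c\<^sub>X \<and>
      prob_density f\<^sub>X \<and>
      (\<forall>x. C\<^sub>X * (1 + \<bar>x\<bar>) powr (- \<beta> - 2) \<ge> f\<^sub>X x \<and> f\<^sub>X x \<ge> c\<^sub>X * (1 + \<bar>x\<bar>) powr (- \<beta> - 2)) \<and>
      (\<forall>n. estimator n (fhat n))
      \<longrightarrow> liminf (\<lambda>n. ennreal (real n powr (2 * \<alpha> / ((\<alpha> + 2) * (\<beta> + 1)))) *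
            (SUP f\<^sub>A\<in>coeff_class 0 \<alpha> c\<^sub>A c\<^sub>B r\<^sub>A c\<^sub>M. pointwise_risk f\<^sub>X f\<^sub>A n (fhat n) 0)) > 0"
proof (intro exI allI impI, elim conjE)
  fix c\<^sub>A c\<^sub>B r\<^sub>A c\<^sub>M c\<^sub>X C\<^sub>X :: real and f\<^sub>X :: "real \<Rightarrow> real"
    and fhat :: "nat \<Rightarrow> (nat \<Rightarrow> real \<times> real) \<Rightarrow> real \<times> real \<Rightarrow> real"
  assume cA: "c\<^sub>A \<ge> 2 * (deriv_bound (strict_floor \<alpha>))\<^sup>2" and cB: "c\<^sub>B \<ge> 8"
    and cM: "c\<^sub>M > 0" and cX: "c\<^sub>X > 0" "C\<^sub>X > c\<^sub>X" and fX: "prob_density f\<^sub>X"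
    and fX_tail: "\<forall>x. C\<^sub>X * (1 + \<bar>x\<bar>) powr (- \<beta> - 2) \<ge> f\<^sub>X x \<and> f\<^sub>X x \<ge> c\<^sub>X * (1 + \<bar>x\<bar>) powr (- \<beta> - 2)"
    and est: "\<forall>n. estimator n (fhat n)"
  define K where "K = 2 * C\<^sub>X / (\<beta> + 1)"
  define \<kappa> where "\<kappa> = 4 * (2 * fejer_mass) ^ 4"
  have \<kappa>: "\<kappa> > 0" using fejer_mass_pos by (simp add: \<kappa>_def)
  have "(\<lambda>n. (1 + (- K) / real n) ^ n) \<longlonglongrightarrow> exp (- K)"
    by (rule tendsto_exp_limit_sequentially)
  then have ev1: "\<forall>\<^sub>F n in sequentially. exp (- K) / 2 < (1 + (- K) / real n) ^ n"
    by (rule order_tendstoD) simp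
  \<comment> \<open>The densities are bounded by a multiple of \<open>\<sigma> \<tau>\<close>, which eventually falls below any given \<open>c\<^sub>M\<close>.\<close>
  have "((\<lambda>n. real n powr (- \<alpha> / ((\<alpha> + 2) * (\<beta> + 1)))) \<longlongrightarrow> 0) sequentially"
    using assms by (intro tendsto_neg_powr filterlim_real_sequentially) (auto intro!: divide_neg_pos)
  then have "((\<lambda>n. real n powr (- \<alpha> / ((\<alpha> + 2) * (\<beta> + 1))) * (2 / fejer_mass)\<^sup>2) \<longlongrightarrow> 0) sequentially"
    by (rule tendsto_mult_left_zero)
  then have ev2: "\<forall>\<^sub>F n in sequentially. real n powr (- \<alpha> / ((\<alpha> + 2) * (\<beta> + 1))) * (2 / fejer_mass)\<^sup>2 < c\<^sub>M"
    using cM by (rule order_tendstoD)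
  have ev3: "\<forall>\<^sub>F n in sequentially. K \<le> real n"
    by (rule filterlim_real_sequentially[unfolded filterlim_at_top, rule_format])
  have "0 < ennreal (exp (- K) / 2 / \<kappa>)" using \<kappa> by simp
  also have "\<dots> \<le> liminf (\<lambda>n. ennreal (real n powr (2 * \<alpha> / ((\<alpha> + 2) * (\<beta> + 1)))) *
            (SUP f\<^sub>A\<in>coeff_class 0 \<alpha> c\<^sub>A c\<^sub>B r\<^sub>A c\<^sub>M. pointwise_risk f\<^sub>X f\<^sub>A n (fhat n) 0))"
  proof (rule Liminf_bounded)
    show "\<forall>\<^sub>F n in sequentially. ennreal (exp (- K) / 2 / \<kappa>)
        \<le> ennreal (real n powr (2 * \<alpha> / ((\<alpha> + 2) * (\<beta> + 1)))) *
            (SUP f\<^sub>A\<in>coeff_class 0 \<alpha> c\<^sub>A c\<^sub>B r\<^sub>A c\<^sub>M. pointwise_risk f\<^sub>X f\<^sub>A n (fhat n) 0)"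
      using ev1 ev2 ev3 eventually_ge_at_top[of 1]
    proof eventually_elim
      case (elim n)
      have "ennreal (exp (- K) / 2 / \<kappa>) \<le> ennreal ((1 - K / real n) ^ n / \<kappa>)"
        using elim(1) \<kappa> by (intro ennreal_leI divide_right_mono) auto
      also have "\<dots> \<le> ennreal (real n powr (2 * \<alpha> / ((\<alpha> + 2) * (\<beta> + 1)))) *
            (SUP f\<^sub>A\<in>coeff_class 0 \<alpha> c\<^sub>A c\<^sub>B r\<^sub>A c\<^sub>M. pointwise_risk f\<^sub>X f\<^sub>A n (fhat n) 0)"
        unfolding K_def \<kappa>_def
        using assms cX fX fX_tail est elim cA cB
        by (intro risk_lower_bound) (auto simp: K_def)
      finally show ?case .
    qed
  qed
  finally show "liminf (\<lambda>n. ennreal (real n powr (2 * \<alpha> / ((\<alpha> + 2) * (\<beta> + 1)))) *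
            (SUP f\<^sub>A\<in>coeff_class 0 \<alpha> c\<^sub>A c\<^sub>B r\<^sub>A c\<^sub>M. pointwise_risk f\<^sub>X f\<^sub>A n (fhat n) 0)) > 0" .
qed

end
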